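(* Let $X$ be a connected bridgeless graph with a chosen basepoint $x_0$ and with $Z_1(X,\mathbb{R})$ finite-dimensional. Let $i\colon A\to Z_1(X,\mathbb{R})$ be the map $i(\llbracket\alpha\rrbracket)=\pi(c_\alpha)$ on the set $A$ of atoms, let $j\colon|\overline{X}|\to Z_1(X,\mathbb{R})$ be the unique extension of $i$ that is affine on bonds (an embedding), and let $\rho$ be the unique action of $\mathrm{Cov}(X)$ by affine transformations of $Z_1(X,\mathbb{R})$ with $\rho(g)i(\llbracket\alpha\rrbracket)=i(g\llbracket\alpha\rrbracket)$ for all $g\in\mathrm{Cov}(X)$, $\llbracket\alpha\rrbracket\in A$. Then $j$ is equivariant with respect to the action of $\mathrm{Cov}(X)$, meaning that $$\rho(g)\,j(p)=j(|g|(p))$$ for all $g\in\mathrm{Cov}(X)$ and $p\in|\overline{X}|$.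
   Context: Graphs. A graph $X=(E,V,s,t,\mathrm{inv})$ consists of a set $V$ of vertices, a set $E$ of edges, source and target maps $s,t\colon E\to V$, and a map $\mathrm{inv}\colon E\to E$, $e\mapsto e^{-1}$, with $s(e^{-1})=t(e)$, $t(e^{-1})=s(e)$, $(e^{-1})^{-1}=e$ and $e^{-1}\neq e$ for all $e$. Write $e\colon v\to w$ if $s(e)=v$, $t(e)=w$. An edge $e$ is a bridge if removing it (together with $e^{-1}$) disconnects the graph; a graph is bridgeless if it has no bridges. A map of graphs is a pair of functions, on vertices and on edges, preserving source, target and inverse; an automorphism is an invertible map of graphs from a graph to itself. Paths. A path $\gamma\colon x\to y$ is a word of edges $\gamma=e_1\cdots e_\ell$ with $e_k\colon v_{k-1}\to v_k$, $v_0=x$, $v_\ell=y$; the empty word is allowed iff $x=y$ (trivial path). Paths are composed by concatenation. A loop based at $x$ is a path $x\to x$. Two paths are homologous if one can be obtained from the other by finitely many moves of the following types: introducing or deleting a subword $e e^{-1}$; replacing a subword $\lambda\mu$ by $\mu\lambda$, where $\lambda,\mu$ are loops based at the same vertex. $\llbracket\gamma\rrbracket$ denotes the homology class of $\gamma$. Maximal abelian cover. The vertices of $\overline{X}$, called atoms, are the homology classes $\llbracket\alpha\rrbracket\colon x_0\to x$ of paths starting at $x_0$; $A$ is the set of atoms. The edges of $\overline{X}$ are the pairs $(\llbracket\alpha\rrbracket\colon x_0\to x,\ e\colon x\to y)$, with source $\llbracket\alpha\rrbracket$, target $\llbracket\alpha e\rrbracket$ and inverse $(\llbracket\alpha e\rrbracket,e^{-1})$.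 The covering map $q\colon\overline{X}\to X$ sends $\llbracket\alpha\rrbracket\colon x_0\to x$ to $x$ and $(\llbracket\alpha\rrbracket,e)$ to $e$. $\mathrm{Cov}(X)$ is the group of automorphisms $g$ of $\overline{X}$ for which there is an automorphism $f$ of $X$ with $q\circ g=f\circ q$. Geometric realization. For a graph $Y$, $|Y|$ is the space obtained by taking one point for each vertex, gluing on a copy of $[0,1]$ for each edge $e\colon v\to w$ with $0$ glued to $v$ and $1$ glued to $w$, and identifying the interval of $e$ with that of $e^{-1}$ via $t\mapsto 1-t$. An automorphism $g$ of $Y$ induces the automorphism $|g|$ of $|Y|$ that sends the point with parameter $t$ on the interval of $e$ to the point with parameter $t$ on the interval of $g(e)$, and the point of a vertex $v$ to that of $g(v)$. The closed intervals in $|\overline{X}|$ given by edges of $\overline{X}$ are called bonds, each edge giving a parametrization $\phi\colon[0,1]\to|\overline{X}|$. A map $f\colon|\overline{X}|\to W$ to a finite-dimensional real vector space is affine on bonds if for every bond, $f(\phi(t))=a+bt$ for some $a,b\in W$ and all $t\in[0,1]$. Chains. $C_0(X,\mathbb{Z})$ is the free abelian group on $V$; $C_1(X,\mathbb{Z})$ is the free abelian group on $E$ modulo the relations $e^{-1}=-e$; $\partial e=t(e)-s(e)$. $C_k(X,\mathbb{R})=C_k(X,\mathbb{Z})\otimes\mathbb{R}$, and $Z_1(X,\mathbb{R})=\ker(\partial\colon C_1(X,\mathbb{R})\to C_0(X,\mathbb{R}))$. $C_1(X,\mathbb{R})$ has the inner product for which edges form an orthonormal basis (one edge chosen from each pair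 $\{e,e^{-1}\}$, with $e^{-1}=-e$), and $\pi\colon C_1(X,\mathbb{R})\to Z_1(X,\mathbb{R})$ is the orthogonal projection. For a path $\gamma=e_1\cdots e_n$, $c_\gamma=e_1+\cdots+e_n$. Homologous paths give the same 1-chain, so $i$ is well-defined. *)

theory Defs
  imports
    "HOL-Analysis.Analysis"
    "HOL-Analysis.Finite_Function_Topology"
    "HOL-Algebra.Group_Action"
    "Graph_Theory.Graph_Theory"
begin

text \<open>
  A graph \<open>(E, V, s, t, inv)\<close> in which every edge \<open>e\<close> has an inverse \<open>e\<inverse> \<noteq> e\<close> is a pair \<open>X\<close>, \<open>iv\<close>
  with \<^prop>\<open>bidirected_digraph X iv\<close>: \<open>V\<close>, \<open>E\<close>, \<open>s\<close>, \<open>t\<close> are \<^term>\<open>verts X\<close>, \<^term>\<open>arcs X\<close>,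
  \<^term>\<open>tail X\<close>, \<^term>\<open>head X\<close>, and \<open>iv\<close> is the inversion, required by the locale to be the identity
  outside \<^term>\<open>arcs X\<close>.  Graphs may be infinite and may have loops and multiple edges.
  Paths \<open>x \<rightarrow> y\<close> are the words \<open>p\<close> with \<^prop>\<open>pre_digraph.awalk X x p y\<close>.
\<close>

text \<open>``Disconnects'' presupposes that the ambient graph \<open>X\<close> is connected.\<close>

definition is_bridge :: "('a,'b) pre_digraph \<Rightarrow> ('b \<Rightarrow> 'b) \<Rightarrow> 'b \<Rightarrow> bool" where
  "is_bridge X iv e \<longleftrightarrow> e \<in> arcs X \<and>
     \<not> Digraph_Component.connected (pre_digraph.del_arc (pre_digraph.del_arc X e) (iv e))"

definition bridgeless :: "('a,'b) pre_digraph \<Rightarrow> ('b \<Rightarrow> 'b) \<Rightarrow> bool" where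
  "bridgeless X iv \<longleftrightarrow> (\<forall>e. \<not> is_bridge X iv e)"

text \<open>Both components of a graph map are extensional, so that equal maps are equal as pairs.\<close>

definition graph_maps ::
  "('a,'b) pre_digraph \<Rightarrow> ('b \<Rightarrow> 'b) \<Rightarrow> ('c,'d) pre_digraph \<Rightarrow> ('d \<Rightarrow> 'd)
    \<Rightarrow> (('a \<Rightarrow> 'c) \<times> ('b \<Rightarrow> 'd)) set" where
  "graph_maps X iv Y jv = {\<phi>.
     fst \<phi> \<in> verts X \<rightarrow>\<^sub>E verts Y \<and> snd \<phi> \<in> arcs X \<rightarrow>\<^sub>E arcs Y \<and>
     (\<forall>e\<in>arcs X. tail Y (snd \<phi> e) = fst \<phi> (tail X e) \<and>
                 head Y (snd \<phi> e) = fst \<phi> (head X e) \<and>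
                 snd \<phi> (iv e) = jv (snd \<phi> e))}"

definition gm_comp ::
  "('a,'b) pre_digraph \<Rightarrow> ('c \<Rightarrow> 'e) \<times> ('d \<Rightarrow> 'f) \<Rightarrow> ('a \<Rightarrow> 'c) \<times> ('b \<Rightarrow> 'd)
    \<Rightarrow> ('a \<Rightarrow> 'e) \<times> ('b \<Rightarrow> 'f)" where
  "gm_comp X \<psi> \<phi> = (compose (verts X) (fst \<psi>) (fst \<phi>), compose (arcs X) (snd \<psi>) (snd \<phi>))"

definition graph_End ::
  "('a,'b) pre_digraph \<Rightarrow> ('b \<Rightarrow> 'b) \<Rightarrow> (('a \<Rightarrow> 'a) \<times> ('b \<Rightarrow> 'b)) monoid" where
  "graph_End X iv = \<lparr>carrier = graph_maps X iv X iv, mult = gm_comp X,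
                     one = (\<lambda>v\<in>verts X. v, \<lambda>e\<in>arcs X. e)\<rparr>"

definition graph_Aut ::
  "('a,'b) pre_digraph \<Rightarrow> ('b \<Rightarrow> 'b) \<Rightarrow> (('a \<Rightarrow> 'a) \<times> ('b \<Rightarrow> 'b)) monoid" where
  "graph_Aut X iv = units_of (graph_End X iv)"

text \<open>
  Moves between paths starting at \<open>x\<close>.  The first rule deletes \<open>e e\<inverse>\<close>; introducing it is the
  converse move, supplied by \<^const>\<open>equivclp\<close> below.  A word that starts at \<open>x\<close> determines its end
  point, so homology classes are classes of words.
\<close>

inductive homology_move ::
  "('a,'b) pre_digraph \<Rightarrow> ('b \<Rightarrow> 'b) \<Rightarrow> 'a \<Rightarrow> 'b list \<Rightarrow> 'b list \<Rightarrow> bool"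
  for X iv x where
  cancel: "pre_digraph.awalk X x (p @ [e, iv e] @ q) y
    \<Longrightarrow> homology_move X iv x (p @ [e, iv e] @ q) (p @ q)"
| commute: "\<lbrakk>pre_digraph.awalk X x p z; pre_digraph.awalk X z l z; pre_digraph.awalk X z m z;
     pre_digraph.awalk X z q y\<rbrakk>
    \<Longrightarrow> homology_move X iv x (p @ l @ m @ q) (p @ m @ l @ q)"

definition path_class ::
  "('a,'b) pre_digraph \<Rightarrow> ('b \<Rightarrow> 'b) \<Rightarrow> 'a \<Rightarrow> 'b list \<Rightarrow> 'b list set" where
  "path_class X iv x p = {q. equivclp (homology_move X iv x) p q}"

definition atoms :: "('a,'b) pre_digraph \<Rightarrow> ('b \<Rightarrow> 'b) \<Rightarrow> 'a \<Rightarrow> 'b list set set" where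
  "atoms X iv x0 = {path_class X iv x0 p |p x. pre_digraph.awalk X x0 p x}"

text \<open>The head of \<open>(a, e)\<close> is a union of equal classes, one for each representative of \<open>a\<close>.\<close>

definition cover ::
  "('a,'b) pre_digraph \<Rightarrow> ('b \<Rightarrow> 'b) \<Rightarrow> 'a \<Rightarrow> ('b list set, 'b list set \<times> 'b) pre_digraph" where
  "cover X iv x0 =
     \<lparr>verts = atoms X iv x0,
      arcs = {(path_class X iv x0 p, e) |p e. e \<in> arcs X \<and> pre_digraph.awalk X x0 p (tail X e)},
      tail = fst,
      head = (\<lambda>(a, e). \<Union>p\<in>a. path_class X iv x0 (p @ [e]))\<rparr>"

definition cover_inv ::
  "('a,'b) pre_digraph \<Rightarrow> ('b \<Rightarrow> 'b) \<Rightarrow> 'a \<Rightarrow> 'b list set \<times> 'b \<Rightarrow> 'b list set \<times> 'b" where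
  "cover_inv X iv x0 d =
     (if d \<in> arcs (cover X iv x0) then (head (cover X iv x0) d, iv (snd d)) else d)"

definition covering_map ::
  "('a,'b) pre_digraph \<Rightarrow> ('b \<Rightarrow> 'b) \<Rightarrow> 'a \<Rightarrow> ('b list set \<Rightarrow> 'a) \<times> ('b list set \<times> 'b \<Rightarrow> 'b)" where
  "covering_map X iv x0 =
     (\<lambda>a\<in>verts (cover X iv x0). THE x. \<exists>p\<in>a. pre_digraph.awalk X x0 p x,
      \<lambda>d\<in>arcs (cover X iv x0). snd d)"

definition Cov ::
  "('a,'b) pre_digraph \<Rightarrow> ('b \<Rightarrow> 'b) \<Rightarrow> 'a
    \<Rightarrow> (('b list set \<Rightarrow> 'b list set) \<times> ('b list set \<times> 'b \<Rightarrow> 'b list set \<times> 'b)) monoid" where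
  "Cov X iv x0 = (graph_Aut (cover X iv x0) (cover_inv X iv x0))
     \<lparr>carrier := {g \<in> carrier (graph_Aut (cover X iv x0) (cover_inv X iv x0)).
        \<exists>f\<in>carrier (graph_Aut X iv).
          gm_comp (cover X iv x0) (covering_map X iv x0) g =
          gm_comp (cover X iv x0) f (covering_map X iv x0)}\<rparr>"

text \<open>
  \<^term>\<open>Inl v\<close> is the point of the vertex \<open>v\<close>, and \<^term>\<open>Inr (e, t)\<close> is the point with parameter
  \<open>t\<close> on the interval of the edge \<open>e\<close>.
\<close>

definition prepoints :: "('a,'b) pre_digraph \<Rightarrow> ('a + 'b \<times> real) set" where
  "prepoints Y = Inl ` verts Y \<union> Inr ` (arcs Y \<times> {0..1})"

inductive glue ::
  "('a,'b) pre_digraph \<Rightarrow> ('b \<Rightarrow> 'b) \<Rightarrow> 'a + 'b \<times> real \<Rightarrow> 'a + 'b \<times> real \<Rightarrow> bool"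
  for Y iv where
  glue_source: "e \<in> arcs Y \<Longrightarrow> glue Y iv (Inr (e, 0)) (Inl (tail Y e))"
| glue_target: "e \<in> arcs Y \<Longrightarrow> glue Y iv (Inr (e, 1)) (Inl (head Y e))"
| glue_inverse: "\<lbrakk>e \<in> arcs Y; t \<in> {0..1}\<rbrakk> \<Longrightarrow> glue Y iv (Inr (e, t)) (Inr (iv e, 1 - t))"

definition glue_class ::
  "('a,'b) pre_digraph \<Rightarrow> ('b \<Rightarrow> 'b) \<Rightarrow> 'a + 'b \<times> real \<Rightarrow> ('a + 'b \<times> real) set" where
  "glue_class Y iv P = {Q. equivclp (glue Y iv) P Q}"

abbreviation vertex_point ::
  "('a,'b) pre_digraph \<Rightarrow> ('b \<Rightarrow> 'b) \<Rightarrow> 'a \<Rightarrow> ('a + 'b \<times> real) set" where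
  "vertex_point Y iv v \<equiv> glue_class Y iv (Inl v)"

abbreviation bond ::
  "('a,'b) pre_digraph \<Rightarrow> ('b \<Rightarrow> 'b) \<Rightarrow> 'b \<Rightarrow> real \<Rightarrow> ('a + 'b \<times> real) set" where
  "bond Y iv e t \<equiv> glue_class Y iv (Inr (e, t))"

text \<open>
  The quotient topology; as the vertices form a discrete space, only the preimages in the intervals
  matter.
\<close>

definition geometric_realization ::
  "('a,'b) pre_digraph \<Rightarrow> ('b \<Rightarrow> 'b) \<Rightarrow> ('a + 'b \<times> real) set topology" where
  "geometric_realization Y iv = topology (\<lambda>U. U \<subseteq> glue_class Y iv ` prepoints Y \<and>
     (\<forall>e\<in>arcs Y. openin (top_of_set {0..1}) {t \<in> {0..1}. bond Y iv e t \<in> U}))"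

definition realization_map ::
  "('a,'b) pre_digraph \<Rightarrow> ('b \<Rightarrow> 'b) \<Rightarrow> ('a \<Rightarrow> 'a) \<times> ('b \<Rightarrow> 'b)
    \<Rightarrow> ('a + 'b \<times> real) set \<Rightarrow> ('a + 'b \<times> real) set" where
  "realization_map Y iv g c =
     (\<Union>P\<in>c. glue_class Y iv (map_sum (fst g) (map_prod (snd g) id) P))"

definition affine_on_bonds ::
  "('a,'b) pre_digraph \<Rightarrow> ('b \<Rightarrow> 'b) \<Rightarrow> 'w::real_vector set
    \<Rightarrow> (('a + 'b \<times> real) set \<Rightarrow> 'w) \<Rightarrow> bool" where
  "affine_on_bonds Y iv W f \<longleftrightarrow>
     (\<forall>d\<in>arcs Y. \<exists>a\<in>W. \<exists>b\<in>W. \<forall>t\<in>{0..1}. f (bond Y iv d t) = a + t *\<^sub>R b)"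

text \<open>
  \<open>C\<^sub>0(X,\<real>)\<close> consists of finitely supported functions on the vertices.  \<open>C\<^sub>1(X,\<real>)\<close>, the real vector
  space generated by the edges subject to \<open>e\<inverse> = -e\<close>, is modelled by the finitely supported
  functions on \<^term>\<open>arcs X\<close> that are antisymmetric under inversion: the value at \<open>e\<close> is the
  coefficient of \<open>e\<close>.  Lemmas \<open>chain_lift_edge_chain\<close> and \<open>chain_lift_unique\<close> below are the
  universal property of that quotient, and \<open>chain_inner_edge_chain\<close> is the orthonormality of the edges.
\<close>

definition chains1 :: "('a,'b) pre_digraph \<Rightarrow> ('b \<Rightarrow> 'b) \<Rightarrow> ('b \<Rightarrow>\<^sub>0 real) set" where
  "chains1 X iv = {c. Poly_Mapping.keys c \<subseteq> arcs X \<and>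
     (\<forall>e\<in>arcs X. Poly_Mapping.lookup c (iv e) = - Poly_Mapping.lookup c e)}"

definition edge_chain :: "('b \<Rightarrow> 'b) \<Rightarrow> 'b \<Rightarrow> 'b \<Rightarrow>\<^sub>0 real" where
  "edge_chain iv e = Poly_Mapping.single e 1 - Poly_Mapping.single (iv e) 1"

definition path_chain :: "('b \<Rightarrow> 'b) \<Rightarrow> 'b list \<Rightarrow> 'b \<Rightarrow>\<^sub>0 real" where
  "path_chain iv p = sum_list (map (edge_chain iv) p)"

text \<open>
  The linear extension of an assignment \<open>h\<close> with \<open>h(e\<inverse>) = -h(e)\<close>; the factor \<open>1/2\<close> is there because
  the sum meets each pair \<open>e\<close>, \<open>e\<inverse>\<close> twice.  Likewise for the inner product.
\<close>

definition chain_lift :: "('b \<Rightarrow> 'w::real_vector) \<Rightarrow> ('b \<Rightarrow>\<^sub>0 real) \<Rightarrow> 'w" where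
  "chain_lift h c =
     (1 / 2) *\<^sub>R (\<Sum>e\<in>Poly_Mapping.keys c. Poly_Mapping.lookup c e *\<^sub>R h e)"

definition chain_boundary ::
  "('a,'b) pre_digraph \<Rightarrow> ('b \<Rightarrow>\<^sub>0 real) \<Rightarrow> ('a \<Rightarrow>\<^sub>0 real)" where
  "chain_boundary X =
     chain_lift (\<lambda>e. Poly_Mapping.single (head X e) 1 - Poly_Mapping.single (tail X e) 1)"

definition cycles1 :: "('a,'b) pre_digraph \<Rightarrow> ('b \<Rightarrow> 'b) \<Rightarrow> ('b \<Rightarrow>\<^sub>0 real) set" where
  "cycles1 X iv = {c \<in> chains1 X iv. chain_boundary X c = 0}"

definition chain_inner :: "('b \<Rightarrow>\<^sub>0 real) \<Rightarrow> ('b \<Rightarrow>\<^sub>0 real) \<Rightarrow> real" where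
  "chain_inner c d =
     (1 / 2) * (\<Sum>e\<in>Poly_Mapping.keys c. Poly_Mapping.lookup c e * Poly_Mapping.lookup d e)"

definition cycle_proj ::
  "('a,'b) pre_digraph \<Rightarrow> ('b \<Rightarrow> 'b) \<Rightarrow> ('b \<Rightarrow>\<^sub>0 real) \<Rightarrow> ('b \<Rightarrow>\<^sub>0 real)" where
  "cycle_proj X iv c =
     (THE z. z \<in> cycles1 X iv \<and> (\<forall>w\<in>cycles1 X iv. chain_inner (c - z) w = 0))"

definition atom_map ::
  "('a,'b) pre_digraph \<Rightarrow> ('b \<Rightarrow> 'b) \<Rightarrow> 'a \<Rightarrow> 'b list set \<Rightarrow> ('b \<Rightarrow>\<^sub>0 real)" where
  "atom_map X iv x0 a = (THE z. \<exists>p\<in>a. z = cycle_proj X iv (path_chain iv p))"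

definition is_affine_extension ::
  "('a,'b) pre_digraph \<Rightarrow> ('b \<Rightarrow> 'b) \<Rightarrow> 'a
    \<Rightarrow> (('b list set + ('b list set \<times> 'b) \<times> real) set \<Rightarrow> ('b \<Rightarrow>\<^sub>0 real)) \<Rightarrow> bool" where
  "is_affine_extension X iv x0 j \<longleftrightarrow>
     j \<in> topspace (geometric_realization (cover X iv x0) (cover_inv X iv x0)) \<rightarrow>\<^sub>E cycles1 X iv \<and>
     (\<forall>a\<in>atoms X iv x0.
        j (vertex_point (cover X iv x0) (cover_inv X iv x0) a) = atom_map X iv x0 a) \<and>
     affine_on_bonds (cover X iv x0) (cover_inv X iv x0) (cycles1 X iv) j"

definition realization_embedding ::
  "('a,'b) pre_digraph \<Rightarrow> ('b \<Rightarrow> 'b) \<Rightarrow> 'a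
    \<Rightarrow> ('b list set + ('b list set \<times> 'b) \<times> real) set \<Rightarrow> ('b \<Rightarrow>\<^sub>0 real)" where
  "realization_embedding X iv x0 = (THE j. is_affine_extension X iv x0 j)"

definition affine_transformation :: "'w::real_vector set \<Rightarrow> ('w \<Rightarrow> 'w) \<Rightarrow> bool" where
  "affine_transformation W T \<longleftrightarrow>
     T \<in> Bij W \<and> (\<exists>L b. linear L \<and> (\<forall>w\<in>W. T w = L w + b))"

text \<open>
  \<^const>\<open>group_action\<close> only constrains the action on the carrier of the group; extensionality fixes the
  remaining values, so that uniqueness can be expressed by equality of functions.
\<close>

definition is_affine_Cov_action ::
  "('a,'b) pre_digraph \<Rightarrow> ('b \<Rightarrow> 'b) \<Rightarrow> 'a
    \<Rightarrow> (('b list set \<Rightarrow> 'b list set) \<times> ('b list set \<times> 'b \<Rightarrow> 'b list set \<times> 'b)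
         \<Rightarrow> ('b \<Rightarrow>\<^sub>0 real) \<Rightarrow> ('b \<Rightarrow>\<^sub>0 real)) \<Rightarrow> bool" where
  "is_affine_Cov_action X iv x0 \<rho> \<longleftrightarrow>
     \<rho> \<in> extensional (carrier (Cov X iv x0)) \<and>
     group_action (Cov X iv x0) (cycles1 X iv) \<rho> \<and>
     (\<forall>g\<in>carrier (Cov X iv x0). affine_transformation (cycles1 X iv) (\<rho> g)) \<and>
     (\<forall>g\<in>carrier (Cov X iv x0). \<forall>a\<in>atoms X iv x0.
        \<rho> g (atom_map X iv x0 a) = atom_map X iv x0 (fst g a))"

definition affine_Cov_action ::
  "('a,'b) pre_digraph \<Rightarrow> ('b \<Rightarrow> 'b) \<Rightarrow> 'a
    \<Rightarrow> ('b list set \<Rightarrow> 'b list set) \<times> ('b list set \<times> 'b \<Rightarrow> 'b list set \<times> 'b)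
    \<Rightarrow> ('b \<Rightarrow>\<^sub>0 real) \<Rightarrow> ('b \<Rightarrow>\<^sub>0 real)" where
  "affine_Cov_action X iv x0 = (THE \<rho>. is_affine_Cov_action X iv x0 \<rho>)"

lemma homology_move_awalk:
  assumes "bidirected_digraph X iv" and "homology_move X iv x p q"
  shows "pre_digraph.awalk X x p y \<longleftrightarrow> pre_digraph.awalk X x q y"
proof -
  interpret bidirected_digraph X iv by fact
  from assms(2) show ?thesis
  proof cases
    case (cancel p' e q' y')
    let ?z = "awlast x p'"
    have "awalk x p' ?z" and w: "awalk ?z (e # iv e # q') y'"
      using cancel(3) by simp_all
    have e: "e \<in> arcs X" and z: "?z = tail X e"
      using w by (simp_all add: awalk_Cons_iff)
    have "awalk ?z (e # iv e # q') y \<longleftrightarrow> awalk ?z q' y"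
      using e unfolding z awalk_Cons_iff by simp
    then show ?thesis
      unfolding cancel(1,2) awalk_append_iff[of x p'] by simp
  next
    case (commute p' z l m q' y')
    then have "awlast z l = z" "awlast z m = z" "awlast x p' = z"
      by (auto simp: awalk_def)
    then show ?thesis
      using commute(3-5) unfolding commute(1,2) awalk_append_iff by simp
  qed
qed

lemma homologous_awalk:
  assumes "bidirected_digraph X iv" and "q \<in> path_class X iv x p"
  shows "pre_digraph.awalk X x p y \<longleftrightarrow> pre_digraph.awalk X x q y"
proof -
  have "equivclp (homology_move X iv x) p q" using assms(2) by (simp add: path_class_def)
  then show ?thesis
  proof (induction rule: equivclp_induct)
    case (step q r)
    then show ?case
      using homology_move_awalk[OF assms(1), of x q r y] homology_move_awalk[OF assms(1), of x r q y]
      by auto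
  qed simp
qed

lemma path_class_self: "p \<in> path_class X iv x p"
  by (simp add: path_class_def)

lemma path_class_eq:
  assumes "q \<in> path_class X iv x p"
  shows "path_class X iv x q = path_class X iv x p"
  using assms equivp_evquivclp[of "homology_move X iv x"]
  unfolding path_class_def equivp_def by simp

lemma path_class_append:
  assumes "bidirected_digraph X iv" and "q \<in> path_class X iv x p"
    and "pre_digraph.awalk X x (p @ r) y"
  shows "q @ r \<in> path_class X iv x (p @ r)"
proof -
  interpret bidirected_digraph X iv by fact
  have step: "homology_move X iv x (a @ r) (b @ r)"
    if m: "homology_move X iv x a b" and w: "awalk x (a @ r) y" for a b
    using m
  proof cases
    case (cancel p' e q' y')
    then show ?thesis
      using w homology_move.cancel[where p = p' and q = "q' @ r" and e = e and X = X and y = y]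
      by simp
  next
    case (commute p' z l m q' y')
    have "awlast z l = z" "awlast z m = z" "awlast x p' = z"
      using commute by (auto simp: awalk_def)
    then have "awalk z (q' @ r) y"
      using w unfolding commute(1) by simp
    from homology_move.commute[OF commute(3-5) this] show ?thesis
      by (simp add: commute(1,2))
  qed
  have "equivclp (homology_move X iv x) p q" using assms(2) by (simp add: path_class_def)
  then have "equivclp (homology_move X iv x) (p @ r) (q @ r) \<and> awalk x (q @ r) y"
  proof (induction rule: equivclp_induct)
    case base
    show ?case using assms(3) by simp
  next
    case (step b c)
    have "awalk x b (awlast x b)" and r: "awalk (awlast x b) r y"
      using step by simp_all
    then have "awalk x c (awlast x b)"
      using step(2) homology_move_awalk[OF assms(1), of x b c "awlast x b"]
        homology_move_awalk[OF assms(1), of x c b "awlast x b"] by blast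
    from awalk_appendI[OF this r] have "awalk x (c @ r) y" .
    moreover from this step have "homology_move X iv x (b @ r) (c @ r) \<or> homology_move X iv x (c @ r) (b @ r)"
      using \<open>\<And>b a. homology_move X iv x a b \<Longrightarrow> awalk x (a @ r) y \<Longrightarrow> homology_move X iv x (a @ r) (b @ r)\<close> by blast
    ultimately show ?case
      using step by (meson equivclp_into_equivclp)
  qed
  then show ?thesis by (simp add: path_class_def)
qed

lemma atomsI: "pre_digraph.awalk X x0 p x \<Longrightarrow> path_class X iv x0 p \<in> atoms X iv x0"
  by (auto simp: atoms_def)

lemma cover_head:
  assumes "bidirected_digraph X iv" and "pre_digraph.awalk X x0 p (tail X e)" and "e \<in> arcs X"
  shows "head (cover X iv x0) (path_class X iv x0 p, e) = path_class X iv x0 (p @ [e])"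
proof -
  interpret bidirected_digraph X iv by fact
  have w: "awalk x0 (p @ [e]) (head X e)"
    using assms(2,3) awalk_appendI[of x0 p "tail X e" "[e]"]
    by (simp add: awalk_Cons_iff awalk_Nil_iff del: awalk_append_iff)
  have "path_class X iv x0 (q @ [e]) = path_class X iv x0 (p @ [e])"
    if "q \<in> path_class X iv x0 p" for q
    using path_class_append[OF assms(1) that w] by (rule path_class_eq)
  then have "(\<Union>q\<in>path_class X iv x0 p. path_class X iv x0 (q @ [e])) = path_class X iv x0 (p @ [e])"
    using path_class_self[of p X iv x0] by blast
  then show ?thesis by (simp add: cover_def)
qed

lemma cover_bidirected:
  assumes "bidirected_digraph X iv"
  shows "bidirected_digraph (cover X iv x0) (cover_inv X iv x0)"
proof -
  interpret bidirected_digraph X iv by fact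
  let ?C = "cover X iv x0" and ?I = "cover_inv X iv x0"
  have arcE: "\<exists>p e. d = (path_class X iv x0 p, e) \<and> e \<in> arcs X \<and> awalk x0 p (tail X e)"
    if "d \<in> arcs ?C" for d
    using that by (auto simp: cover_def)
  have ext: "awalk x0 (p @ [e]) (head X e)" if "awalk x0 p (tail X e)" "e \<in> arcs X" for p e
    using that awalk_appendI[of x0 p "tail X e" "[e]"]
    by (simp add: awalk_Cons_iff awalk_Nil_iff del: awalk_append_iff)
  have wf: "wf_digraph ?C"
  proof
    fix d assume "d \<in> arcs ?C"
    then obtain p e where d: "d = (path_class X iv x0 p, e)" "e \<in> arcs X" "awalk x0 p (tail X e)"
      using arcE by blast
    have V: "verts ?C = atoms X iv x0" "tail ?C d = path_class X iv x0 p" 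
      by (simp_all add: cover_def d(1))
    show "tail ?C d \<in> verts ?C" unfolding V using d(3) by (rule atomsI)
    show "head ?C d \<in> verts ?C"
      unfolding V d(1) cover_head[OF assms d(3,2)] using ext[OF d(3,2)] by (rule atomsI)
  qed
  show ?thesis
  proof (rule wf_digraph.bidirected_digraphI[OF wf])
    fix d assume "d \<notin> arcs ?C"
    then show "?I d = d" by (simp add: cover_inv_def)
  next
    fix d assume dC: "d \<in> arcs ?C"
    then obtain p e where d: "d = (path_class X iv x0 p, e)" "e \<in> arcs X" "awalk x0 p (tail X e)"
      using arcE by blast
    note h = cover_head[OF assms d(3,2)]
    have I: "?I d = (path_class X iv x0 (p @ [e]), iv e)"
      using dC h by (simp add: cover_inv_def d(1))
    then show "?I d \<noteq> d" using arev_neq[OF d(2)] by (simp add: d(1))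
    have w: "awalk x0 (p @ [e]) (tail X (iv e))" using ext[OF d(3,2)] d(2) by simp
    have IC: "?I d \<in> arcs ?C" unfolding I using w d(2) by (auto simp: cover_def)
    have "awalk x0 (p @ [e, iv e] @ []) (tail X e)"
      using ext[OF w] d(2) by simp
    then have "homology_move X iv x0 (p @ [e, iv e] @ []) (p @ [])"
      by (rule homology_move.cancel)
    then have "homology_move X iv x0 (p @ [e, iv e]) p" by simp
    then have "p \<in> path_class X iv x0 (p @ [e, iv e])" by (simp add: path_class_def r_into_equivclp)
    then have eq: "path_class X iv x0 (p @ [e, iv e]) = path_class X iv x0 p"
      using path_class_eq by metis
    have hI: "head ?C (?I d) = path_class X iv x0 p"
      unfolding I using cover_head[OF assms w] d(2) eq by simp
    show "?I (?I d) = d"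
    proof -
      have "?I (?I d) = (head ?C (?I d), iv (snd (?I d)))"
        using IC by (subst cover_inv_def) simp
      then show ?thesis unfolding hI by (simp add: I d(1)[symmetric])
    qed
    show "tail ?C (?I d) = head ?C d"
    proof -
      have "tail ?C = fst" by (simp add: cover_def)
      then show ?thesis using I h d(1) by simp
    qed
  qed
qed

lemma covering_map_atom:
  assumes "bidirected_digraph X iv" and "pre_digraph.awalk X x0 p x"
  shows "fst (covering_map X iv x0) (path_class X iv x0 p) = x"
proof -
  interpret bidirected_digraph X iv by fact
  have "path_class X iv x0 p \<in> verts (cover X iv x0)"
    using atomsI[OF assms(2)] by (simp add: cover_def)
  moreover have "(THE y. \<exists>q\<in>path_class X iv x0 p. awalk x0 q y) = x"
  proof (rule the_equality)
    show "\<exists>q\<in>path_class X iv x0 p. awalk x0 q x" using assms(2) path_class_self by (rule bexI)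
    show "y = x" if "\<exists>q\<in>path_class X iv x0 p. awalk x0 q y" for y
    proof -
      have "awalk x0 p y" using that homologous_awalk[OF assms(1)] by blast
      from awalk_ends[OF assms(2) this] show ?thesis by auto
    qed
  qed
  ultimately show ?thesis by (simp add: covering_map_def)
qed

lemma covering_map_graph_map:
  assumes "bidirected_digraph X iv"
  shows "covering_map X iv x0 \<in> graph_maps (cover X iv x0) (cover_inv X iv x0) X iv"
proof -
  interpret bidirected_digraph X iv by fact
  interpret C: bidirected_digraph "cover X iv x0" "cover_inv X iv x0" by (rule cover_bidirected) fact
  have V: "fst (covering_map X iv x0) a \<in> verts X" if aV: "a \<in> verts (cover X iv x0)" for a
  proof -
    obtain p x where "a = path_class X iv x0 p" "awalk x0 p x"
      using aV by (auto simp: cover_def atoms_def)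
    then show ?thesis using covering_map_atom[OF assms] awalk_last_in_verts by metis
  qed
  have A: "snd (covering_map X iv x0) d = snd d" if "d \<in> arcs (cover X iv x0)" for d
    using that by (simp add: covering_map_def)
  have ends: "tail X (snd d) = fst (covering_map X iv x0) (tail (cover X iv x0) d) \<and>
     head X (snd d) = fst (covering_map X iv x0) (head (cover X iv x0) d) \<and> snd d \<in> arcs X"
    if dC: "d \<in> arcs (cover X iv x0)" for d
  proof -
    obtain p e where d: "d = (path_class X iv x0 p, e)" "e \<in> arcs X" "awalk x0 p (tail X e)"
      using dC by (auto simp: cover_def)
    have w: "awalk x0 (p @ [e]) (head X e)"
      using d awalk_appendI[of x0 p "tail X e" "[e]"]
      by (simp add: awalk_Cons_iff awalk_Nil_iff del: awalk_append_iff)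
    have "tail (cover X iv x0) d = path_class X iv x0 p" by (simp add: cover_def d)
    then show ?thesis
      using covering_map_atom[OF assms w] covering_map_atom[OF assms d(3)] d
        cover_head[OF assms d(3,2)] by simp
  qed
  have I: "snd (cover_inv X iv x0 d) = iv (snd d)" if "d \<in> arcs (cover X iv x0)" for d
    using that by (simp add: cover_inv_def)
  show ?thesis
    unfolding graph_maps_def
    using V A ends I C.arev_in_arcs by (auto simp: PiE_def covering_map_def extensional_def)
qed

lemma istopology_geometric_realization:
  "istopology (\<lambda>U. U \<subseteq> glue_class Y iv ` prepoints Y \<and>
     (\<forall>e\<in>arcs Y. openin (top_of_set {0..1}) {t \<in> {0..1}. bond Y iv e t \<in> U}))"
  unfolding istopology_def
proof (intro conjI allI impI ballI, goal_cases)
  case (1 S T)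
  then show ?case by blast
next
  case (2 S T e)
  have "{t \<in> {0..1}. bond Y iv e t \<in> S \<inter> T} =
      {t \<in> {0..1}. bond Y iv e t \<in> S} \<inter> {t \<in> {0..1}. bond Y iv e t \<in> T}" by auto
  then show ?case using 2 by (metis (no_types, lifting) openin_Int)
next
  case (3 K)
  then show ?case by blast
next
  case (4 K e)
  have "{t \<in> {0..1}. bond Y iv e t \<in> \<Union>K} = (\<Union>U\<in>K. {t \<in> {0..1}. bond Y iv e t \<in> U})" by auto
  moreover have "openin (top_of_set {0..1}) (\<Union>U\<in>K. {t \<in> {0..1}. bond Y iv e t \<in> U})"
    using 4 by (intro openin_Union) auto
  ultimately show ?case by simp
qed

lemma topspace_geometric_realization:
  "topspace (geometric_realization Y iv) = glue_class Y iv ` prepoints Y"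
proof -
  have op: "openin (geometric_realization Y iv) U \<longleftrightarrow> U \<subseteq> glue_class Y iv ` prepoints Y \<and>
     (\<forall>e\<in>arcs Y. openin (top_of_set {0..1}) {t \<in> {0..1}. bond Y iv e t \<in> U})" for U
    unfolding geometric_realization_def
    using topology_inverse'[OF istopology_geometric_realization, of Y iv] by simp
  have "openin (geometric_realization Y iv) (glue_class Y iv ` prepoints Y)"
  proof -
    have "{t \<in> {0..1}. bond Y iv e t \<in> glue_class Y iv ` prepoints Y} = {0..1}"
      if "e \<in> arcs Y" for e
      using that by (auto simp: prepoints_def)
    then show ?thesis unfolding op by auto
  qed
  from openin_subset[OF this] show ?thesis
    using op[of "topspace (geometric_realization Y iv)"] openin_topspace by blast
qed

lemma glue_class_eq_iff: "glue_class Y iv P = glue_class Y iv Q \<longleftrightarrow> equivclp (glue Y iv) P Q"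
  using equivp_evquivclp[of "glue Y iv"] unfolding glue_class_def equivp_def
  by (metis mem_Collect_eq)

lemma bond_ends:
  assumes "e \<in> arcs Y"
  shows "bond Y iv e 0 = vertex_point Y iv (tail Y e)"
    and "bond Y iv e 1 = vertex_point Y iv (head Y e)"
    and "t \<in> {0..1} \<Longrightarrow> bond Y iv (iv e) (1 - t) = bond Y iv e t"
  using assms glue.intros[of e Y]
  unfolding glue_class_eq_iff by (blast intro: r_into_equivclp equivclp_sym)+

lemma realization_map_class:
  assumes "g \<in> graph_maps Y iv Y iv"
  shows "realization_map Y iv g (glue_class Y iv P) =
    glue_class Y iv (map_sum (fst g) (map_prod (snd g) id) P)"
proof -
  let ?m = "map_sum (fst g) (map_prod (snd g) id)"
  have step: "glue Y iv (?m P) (?m Q)" if "glue Y iv P Q" for P Q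
    using that
  proof cases
    case (glue_source e)
    then show ?thesis using assms glue.glue_source[of "snd g e" Y iv] by (auto simp: graph_maps_def)
  next
    case (glue_target e)
    then show ?thesis using assms glue.glue_target[of "snd g e" Y iv] by (auto simp: graph_maps_def)
  next
    case (glue_inverse e t)
    then show ?thesis using assms glue.glue_inverse[of "snd g e" Y t iv]
      by (auto simp: graph_maps_def)
  qed
  have "equivclp (glue Y iv) (?m P) (?m Q)" if "equivclp (glue Y iv) P Q" for Q
    using that
  proof (induction rule: equivclp_induct)
    case base
    show ?case by simp
  next
    case (step y z)
    then show ?case using \<open>\<And>Q P. glue Y iv P Q \<Longrightarrow> glue Y iv (?m P) (?m Q)\<close>
      by (meson equivclp_into_equivclp)
  qed
  then have "glue_class Y iv (?m Q) = glue_class Y iv (?m P)" if "Q \<in> glue_class Y iv P" for Q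
    using that by (metis glue_class_def glue_class_eq_iff mem_Collect_eq)
  moreover have "P \<in> glue_class Y iv P" by (simp add: glue_class_def)
  ultimately show ?thesis unfolding realization_map_def by blast
qed

lemma lookup_scaleR_chain: "Poly_Mapping.lookup (r *\<^sub>R c) e = r * Poly_Mapping.lookup c e"
  for c :: "'b \<Rightarrow>\<^sub>0 real"
  by (simp add: scaleR_poly_mapping_def Abs_poly_mapping_inverse)

lemma chain_lift_superset:
  assumes "finite S" "Poly_Mapping.keys c \<subseteq> S"
  shows "chain_lift h c = (1 / 2) *\<^sub>R (\<Sum>e\<in>S. Poly_Mapping.lookup c e *\<^sub>R h e)"
  unfolding chain_lift_def using assms
  by (intro arg_cong[where f = "scaleR _"] sum.mono_neutral_left) (auto simp: in_keys_iff)

lemma linear_chain_lift: "linear (chain_lift h)"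
proof (rule linearI)
  fix c d :: "'a \<Rightarrow>\<^sub>0 real"
  let ?S = "Poly_Mapping.keys c \<union> Poly_Mapping.keys d"
  have "chain_lift h x = (1 / 2) *\<^sub>R (\<Sum>e\<in>?S. Poly_Mapping.lookup x e *\<^sub>R h e)"
    if "x \<in> {c, d, c + d}" for x
    using that Poly_Mapping.keys_add[of c d] by (intro chain_lift_superset) auto
  then show "chain_lift h (c + d) = chain_lift h c + chain_lift h d"
    by (simp add: lookup_add scaleR_add_left sum.distrib scaleR_add_right)
next
  fix r and c :: "'a \<Rightarrow>\<^sub>0 real"
  have "chain_lift h (r *\<^sub>R c) =
      (1 / 2) *\<^sub>R (\<Sum>e\<in>Poly_Mapping.keys c. Poly_Mapping.lookup (r *\<^sub>R c) e *\<^sub>R h e)"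
    by (rule chain_lift_superset) (auto simp: in_keys_iff lookup_scaleR_chain)
  then show "chain_lift h (r *\<^sub>R c) = r *\<^sub>R chain_lift h c"
    by (simp add: lookup_scaleR_chain chain_lift_def scaleR_sum_right mult.commute)
qed

lemma edge_chain_inverse:
  "bidirected_digraph X iv \<Longrightarrow> edge_chain iv (iv e) = - edge_chain iv e"
  by (simp add: edge_chain_def bidirected_digraph.arev_arev)

lemma edge_chain_in_chains1:
  assumes "bidirected_digraph X iv" and "e \<in> arcs X"
  shows "edge_chain iv e \<in> chains1 X iv"
proof -
  interpret bidirected_digraph X iv by fact
  have "Poly_Mapping.keys (edge_chain iv e) \<subseteq> {e, iv e}"
    by (auto simp: edge_chain_def in_keys_iff lookup_minus lookup_single when_def split: if_splits)
  moreover have "Poly_Mapping.lookup (edge_chain iv e) (iv d) = - Poly_Mapping.lookup (edge_chain iv e) d" for d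
  proof -
    have "e = iv d \<longleftrightarrow> iv e = d" by (metis arev_arev)
    then show ?thesis
      by (simp add: edge_chain_def lookup_minus lookup_single when_def arev_eq_iff)
  qed
  ultimately show ?thesis using assms(2) unfolding chains1_def by auto
qed

lemma chain_lift_edge_chain:
  assumes "bidirected_digraph X iv" and "e \<in> arcs X" and "h (iv e) = - h e"
  shows "chain_lift h (edge_chain iv e) = h e"
proof -
  interpret bidirected_digraph X iv by fact
  have "chain_lift h (edge_chain iv e) =
      (1 / 2) *\<^sub>R (\<Sum>d\<in>{e, iv e}. Poly_Mapping.lookup (edge_chain iv e) d *\<^sub>R h d)"
    by (rule chain_lift_superset)
      (auto simp: edge_chain_def in_keys_iff lookup_minus lookup_single when_def split: if_splits)
  also have "\<dots> = (1 / 2) *\<^sub>R (h e + h e)"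
    using arev_neq[OF assms(2)] assms(3)
    by (simp add: edge_chain_def lookup_minus lookup_single)
  also have "\<dots> = h e" by (simp flip: scaleR_2)
  finally show ?thesis .
qed

lemma subspace_chains1: "subspace (chains1 X iv)"
  unfolding subspace_def chains1_def
  by (auto simp: lookup_add lookup_scaleR_chain in_keys_iff)
    (metis add.right_neutral in_keys_iff subsetD)

lemma chain_lift_chains1:
  assumes "bidirected_digraph X iv" and "c \<in> chains1 X iv"
  shows "chain_lift (edge_chain iv) c = c"
proof (rule poly_mapping_eqI)
  interpret bidirected_digraph X iv by fact
  fix d
  let ?K = "Poly_Mapping.keys c" and ?l = "Poly_Mapping.lookup"
  have l: "?l (sum f S) d = (\<Sum>e\<in>S. ?l (f e) d)" for f :: "'b \<Rightarrow> 'b \<Rightarrow>\<^sub>0 real" and S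
    by (simp add: lookup_sum)
  have K: "d \<in> ?K \<longleftrightarrow> iv d \<in> ?K" and anti: "?l c (iv d) = - ?l c d"
    using assms(2) arev_eq[of d] by (cases "d \<in> arcs X"; force simp: chains1_def in_keys_iff)+
  have "?l (chain_lift (edge_chain iv) c) d =
      (1 / 2) * (\<Sum>e\<in>?K. ?l c e * ((1 when e = d) - (1 when iv e = d)))"
    by (simp add: chain_lift_def lookup_scaleR_chain l edge_chain_def lookup_minus lookup_single)
  also have "(\<Sum>e\<in>?K. ?l c e * ((1 when e = d) - (1 when iv e = d))) =
      (\<Sum>e\<in>?K. if e = d then ?l c e else 0) - (\<Sum>e\<in>?K. if e = iv d then ?l c e else 0)"
    unfolding sum_subtractf[symmetric]
    by (intro sum.cong refl) (auto simp: when_def)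
  also have "\<dots> = ?l c d - ?l c (iv d)"
    by (simp add: sum.delta in_keys_iff)
  finally show "?l (chain_lift (edge_chain iv) c) d = ?l c d" using anti by simp
qed

lemma chains1_eq_span:
  assumes "bidirected_digraph X iv"
  shows "chains1 X iv = span (edge_chain iv ` arcs X)"
proof
  show "span (edge_chain iv ` arcs X) \<subseteq> chains1 X iv"
    by (rule span_minimal) (auto intro: edge_chain_in_chains1[OF assms] subspace_chains1)
  show "chains1 X iv \<subseteq> span (edge_chain iv ` arcs X)"
  proof
    fix c assume c: "c \<in> chains1 X iv"
    then have "chain_lift (edge_chain iv) c \<in> span (edge_chain iv ` arcs X)"
      unfolding chain_lift_def
      by (intro span_scale span_sum) (auto simp: chains1_def intro: span_base)
    then show "c \<in> span (edge_chain iv ` arcs X)" using chain_lift_chains1[OF assms c] by simp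
  qed
qed

lemma chain_lift_unique:
  assumes "bidirected_digraph X iv" and "linear L"
    and "\<And>e. e \<in> arcs X \<Longrightarrow> h (iv e) = - h e"
    and "\<And>e. e \<in> arcs X \<Longrightarrow> L (edge_chain iv e) = h e"
    and "c \<in> chains1 X iv"
  shows "L c = chain_lift h c"
proof (rule linear_eq_on[OF assms(2) linear_chain_lift])
  show "c \<in> span (edge_chain iv ` arcs X)" using assms(1,5) chains1_eq_span by blast
  show "L x = chain_lift h x" if xe: "x \<in> edge_chain iv ` arcs X" for x
  proof -
    obtain e where e: "x = edge_chain iv e" "e \<in> arcs X" using xe by blast
    show ?thesis
      unfolding e(1) using assms(4)[OF e(2)] chain_lift_edge_chain[OF assms(1) e(2) assms(3)[OF e(2)]]
      by simp
  qed
qed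

lemma chain_boundary_edge_chain:
  assumes "bidirected_digraph X iv" and "e \<in> arcs X"
  shows "chain_boundary X (edge_chain iv e) =
    Poly_Mapping.single (head X e) 1 - Poly_Mapping.single (tail X e) 1"
proof -
  interpret bidirected_digraph X iv by fact
  show ?thesis
    unfolding chain_boundary_def
    by (rule chain_lift_edge_chain[OF assms]) (simp add: assms(2))
qed

lemma subspace_cycles1: "subspace (cycles1 X iv)"
proof -
  have "cycles1 X iv = chains1 X iv \<inter> {c. chain_boundary X c = 0}"
    by (auto simp: cycles1_def)
  moreover have "subspace {c. chain_boundary X c = 0}"
    unfolding chain_boundary_def by (rule linear_subspace_kernel[OF linear_chain_lift])
  ultimately show ?thesis using subspace_chains1 subspace_inter by metis
qed

lemma chain_inner_edge_chain:
  assumes "bidirected_digraph X iv" and "e \<in> arcs X"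
  shows "chain_inner (edge_chain iv e) c = (Poly_Mapping.lookup c e - Poly_Mapping.lookup c (iv e)) / 2"
    and "chain_inner (edge_chain iv e) (edge_chain iv d) =
      (if d = e then 1 else if d = iv e then -1 else 0)"
proof -
  interpret bidirected_digraph X iv by fact
  have "(\<Sum>d\<in>Poly_Mapping.keys (edge_chain iv e). Poly_Mapping.lookup (edge_chain iv e) d * Poly_Mapping.lookup c d)
      = (\<Sum>d\<in>{e, iv e}. Poly_Mapping.lookup (edge_chain iv e) d * Poly_Mapping.lookup c d)" for c
    by (rule sum.mono_neutral_left)
      (auto simp: edge_chain_def in_keys_iff lookup_minus lookup_single when_def split: if_splits)
  also have "\<dots> c = Poly_Mapping.lookup c e - Poly_Mapping.lookup c (iv e)" for c
    using arev_neq[OF assms(2)] by (simp add: edge_chain_def lookup_minus lookup_single)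
  finally show *: "chain_inner (edge_chain iv e) c =
      (Poly_Mapping.lookup c e - Poly_Mapping.lookup c (iv e)) / 2" for c
    by (simp add: chain_inner_def)
  have l: "Poly_Mapping.lookup (edge_chain iv d) x =
      (if d = x then 1 else 0) - (if iv d = x then 1 else 0)" for x
    by (simp add: edge_chain_def lookup_minus lookup_single when_def)
  have eq: "iv d = e \<longleftrightarrow> d = iv e" by (metis arev_arev)
  have ne: "e \<noteq> iv e" using arev_neq[OF assms(2)] by simp
  show "chain_inner (edge_chain iv e) (edge_chain iv d) =
      (if d = e then 1 else if d = iv e then -1 else 0)"
    unfolding * l arev_eq_iff eq using ne by (cases "d = e"; cases "d = iv e"; simp)
qed

lemma path_chain_homologous:
  assumes "bidirected_digraph X iv" and "q \<in> path_class X iv x p"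
  shows "path_chain iv q = path_chain iv p"
proof -
  have move: "path_chain iv a = path_chain iv b" if "homology_move X iv x a b" for a b
    using that
    by cases (auto simp: path_chain_def edge_chain_inverse[OF assms(1)])
  have "equivclp (homology_move X iv x) p q" using assms(2) by (simp add: path_class_def)
  then show ?thesis
    by (induction rule: equivclp_induct) (auto dest: move)
qed

lemma atom_map_path_class:
  assumes "bidirected_digraph X iv"
  shows "atom_map X iv x0 (path_class X iv x0 p) = cycle_proj X iv (path_chain iv p)"
  unfolding atom_map_def
proof (rule the_equality)
  show "\<exists>q\<in>path_class X iv x0 p. cycle_proj X iv (path_chain iv p) = cycle_proj X iv (path_chain iv q)"
    by (rule bexI[OF refl path_class_self])
  show "z = cycle_proj X iv (path_chain iv p)"
    if zq: "\<exists>q\<in>path_class X iv x0 p. z = cycle_proj X iv (path_chain iv q)" for z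
  proof -
    obtain q where "q \<in> path_class X iv x0 p" "z = cycle_proj X iv (path_chain iv q)"
      using zq by (rule bexE)
    then show ?thesis using path_chain_homologous[OF assms] by simp
  qed
qed

end

theory Submission
  imports Defs
begin

text \<open>
  An automorphism \<open>g\<close> of the maximal abelian cover that lies over an automorphism \<open>f\<close> of \<open>X\<close> sends
  the class of a path \<open>r\<close> to the class of \<open>p\<close> followed by \<open>f r\<close>, where \<open>p\<close> is a path from the
  basepoint \<open>x\<^sub>0\<close> to \<open>f x\<^sub>0\<close> representing the image of the trivial class (\<open>Cov_path_class\<close>).  As \<open>f\<close> permutes the
  edges, it acts on chains isometrically and preserves cycles, hence commutes with the orthogonal
  projection \<open>\<pi>\<close> onto cycles (\<open>cycle_proj_pushforward\<close>).  Writing \<open>i\<close> for the map from atoms to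
  cycles and \<open>f\<^sub>*\<close> for the action on chains, one obtains \<open>i (g a) = f\<^sub>* (i a) + \<pi> c\<^sub>p\<close>, an affine function
  of \<open>i a\<close> (\<open>Cov_affine\<close>).

  The trivial path maps to \<open>0\<close>, and the difference of \<open>i\<close> at the two ends of a bond over \<open>e\<close> is \<open>\<pi> e\<close>.
  Since \<open>X\<close> is connected, bonds lie over all edges, so the atoms affinely span the space of cycles
  (\<open>span_atom_map\<close>) and an affine map on cycles is determined by its values at atoms
  (\<open>affine_eq_on_atoms\<close>).  This one principle makes the maps \<open>z \<mapsto> f\<^sub>* z + \<pi> c\<^sub>p\<close> compose in the same
  way as the automorphisms \<open>g\<close>, makes them invertible, and makes the resulting action the only one
  compatible with \<open>i\<close>.  Thus \<open>\<rho>\<close> is well defined.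

  The map \<open>j\<close> is well defined too: interpolating linearly along each edge between the
  values of \<open>i\<close> at its ends respects the gluing, and being affine on bonds forces these values.
  Equivariance is now immediate.  It holds at the vertices by the choice of \<open>\<rho>\<close>, and it extends
  to the bonds because \<open>\<rho> g\<close>, being affine, preserves the weighted averages that define \<open>j\<close> there.
\<close>

section \<open>Orthogonal projection onto a finite-dimensional space of chains\<close>

lemma chain_inner_eq_chain_lift: "chain_inner c d = chain_lift (Poly_Mapping.lookup d) c"
  by (simp add: chain_inner_def chain_lift_def)

lemma chain_inner_commute: "chain_inner c d = chain_inner d c"
proof -
  let ?S = "Poly_Mapping.keys c \<union> Poly_Mapping.keys d"
  have "chain_inner c d = (1 / 2) *\<^sub>R (\<Sum>e\<in>?S. Poly_Mapping.lookup c e *\<^sub>R Poly_Mapping.lookup d e)"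
    unfolding chain_inner_eq_chain_lift by (rule chain_lift_superset) auto
  moreover have "chain_inner d c = (1 / 2) *\<^sub>R (\<Sum>e\<in>?S. Poly_Mapping.lookup d e *\<^sub>R Poly_Mapping.lookup c e)"
    unfolding chain_inner_eq_chain_lift by (rule chain_lift_superset) auto
  ultimately show ?thesis by (simp add: mult.commute)
qed

lemma linear_chain_inner_left: "linear (\<lambda>c. chain_inner c d)"
  unfolding chain_inner_eq_chain_lift by (rule linear_chain_lift)

lemma linear_chain_inner_right: "linear (chain_inner c)"
proof -
  have "chain_inner c = (\<lambda>d. chain_inner d c)" by (rule ext) (rule chain_inner_commute)
  then show ?thesis using linear_chain_inner_left[of c] by simp
qed

lemmas chain_inner_simps =
  linear_add[OF linear_chain_inner_left] linear_add[OF linear_chain_inner_right]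
  linear_diff[OF linear_chain_inner_left] linear_diff[OF linear_chain_inner_right]
  linear_cmul[OF linear_chain_inner_left] linear_cmul[OF linear_chain_inner_right]
  linear_0[OF linear_chain_inner_left] linear_0[OF linear_chain_inner_right]

lemma chain_inner_self_eq_0: "chain_inner c c = 0 \<longleftrightarrow> c = 0"
proof
  assume "chain_inner c c = 0"
  then have "(\<Sum>e\<in>Poly_Mapping.keys c. Poly_Mapping.lookup c e * Poly_Mapping.lookup c e) = 0"
    by (simp add: chain_inner_def)
  then have "\<forall>e\<in>Poly_Mapping.keys c. Poly_Mapping.lookup c e * Poly_Mapping.lookup c e = 0"
    by (subst (asm) sum_nonneg_eq_0_iff) auto
  then have "Poly_Mapping.lookup c e = 0" for e
    by (cases "e \<in> Poly_Mapping.keys c") (auto simp: in_keys_iff)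
  then show "c = 0" by (intro poly_mapping_eqI) simp
qed (simp add: chain_inner_def)

text \<open>
  One Gram-Schmidt step for each generator: the part \<open>b'\<close> of a new generator orthogonal to the earlier
  ones adds a multiple of \<open>b'\<close> to the projection.
\<close>

lemma orthogonal_decomposition_exists:
  assumes "finite B"
  shows "\<exists>z\<in>span B. \<forall>w\<in>span B. chain_inner (c - z) w = 0"
  using assms
proof (induction B arbitrary: c rule: finite_induct)
  case empty
  show ?case by (simp add: chain_inner_simps)
next
  case (insert b B)
  obtain u where u: "u \<in> span B" "\<And>w. w \<in> span B \<Longrightarrow> chain_inner (b - u) w = 0"
    using insert.IH[of b] by blast
  obtain z where z: "z \<in> span B" "\<And>w. w \<in> span B \<Longrightarrow> chain_inner (c - z) w = 0"
    using insert.IH[of c] by blast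
  define b' where "b' = b - u"
  \<comment> \<open>If \<open>b' = 0\<close>, the default value of the division makes the coefficient \<open>0\<close>, as it should be.\<close>
  define r where "r = chain_inner (c - z) b' / chain_inner b' b'"
  have b': "b' \<in> span (insert b B)"
    unfolding b'_def using u(1) by (meson insertI1 span_base span_diff span_mono subset_insertI subsetD)
  have r: "r * chain_inner b' b' = chain_inner (c - z) b'"
    by (cases "b' = 0") (simp_all add: r_def chain_inner_simps chain_inner_self_eq_0)
  show ?case
  proof (intro bexI ballI)
    show "z + r *\<^sub>R b' \<in> span (insert b B)"
      using z(1) b' by (meson span_add span_mono span_scale subset_insertI subsetD)
    fix w assume "w \<in> span (insert b B)"
    then obtain k where k: "w - k *\<^sub>R b \<in> span B" using span_breakdown_eq by blast
    define y where "y = w - k *\<^sub>R b + k *\<^sub>R u"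
    have y: "y \<in> span B" unfolding y_def using k u(1) by (intro span_add span_scale)
    have w: "w = y + k *\<^sub>R b'" by (simp add: y_def b'_def algebra_simps)
    have "c - (z + r *\<^sub>R b') = (c - z) - r *\<^sub>R b'" by simp
    then have "chain_inner (c - (z + r *\<^sub>R b')) w
        = chain_inner (c - z) y + k * chain_inner (c - z) b'
          - r * chain_inner b' y - k * (r * chain_inner b' b')"
      unfolding w by (simp add: chain_inner_simps algebra_simps)
    also have "\<dots> = 0" using z(2)[OF y] u(2)[OF y] r by (simp add: b'_def)
    finally show "chain_inner (c - (z + r *\<^sub>R b')) w = 0" .
  qed
qed

locale cycle_finite_graph = bidirected_digraph X iv
  for X :: "('a,'b) pre_digraph" and iv :: "'b \<Rightarrow> 'b" +
  assumes finite_dim_cycles: "\<exists>B. finite B \<and> span B = cycles1 X iv"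
begin

lemma cycle_proj_eqI:
  assumes "z \<in> cycles1 X iv" and "\<And>w. w \<in> cycles1 X iv \<Longrightarrow> chain_inner (c - z) w = 0"
  shows "cycle_proj X iv c = z"
  unfolding cycle_proj_def
proof (rule the_equality)
  fix y assume y: "y \<in> cycles1 X iv \<and> (\<forall>w\<in>cycles1 X iv. chain_inner (c - y) w = 0)"
  have yz: "y - z \<in> cycles1 X iv" using assms(1) y subspace_cycles1 subspace_diff by blast
  have "chain_inner (y - z) (y - z) = chain_inner (c - z) (y - z) - chain_inner (c - y) (y - z)"
    by (simp add: chain_inner_simps)
  then have "chain_inner (y - z) (y - z) = 0" using assms(2)[OF yz] y yz by simp
  then show "y = z" by (simp add: chain_inner_self_eq_0)
qed (use assms in blast)

lemma
  shows cycle_proj_in_cycles1: "cycle_proj X iv c \<in> cycles1 X iv"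
    and cycle_proj_orthogonal: "w \<in> cycles1 X iv \<Longrightarrow> chain_inner (c - cycle_proj X iv c) w = 0"
proof -
  obtain B where "finite B" "span B = cycles1 X iv" using finite_dim_cycles by blast
  then obtain z where "z \<in> cycles1 X iv" "\<And>w. w \<in> cycles1 X iv \<Longrightarrow> chain_inner (c - z) w = 0"
    using orthogonal_decomposition_exists[of B c] by metis
  then show "cycle_proj X iv c \<in> cycles1 X iv"
    and "w \<in> cycles1 X iv \<Longrightarrow> chain_inner (c - cycle_proj X iv c) w = 0"
    using cycle_proj_eqI[of z c] by simp_all
qed

lemma cycle_proj_cycle: "z \<in> cycles1 X iv \<Longrightarrow> cycle_proj X iv z = z"
  by (rule cycle_proj_eqI) (simp_all add: chain_inner_simps)

lemma linear_cycle_proj: "linear (cycle_proj X iv)"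
proof (rule linearI)
  fix c d and r :: real
  show "cycle_proj X iv (c + d) = cycle_proj X iv c + cycle_proj X iv d"
  proof (rule cycle_proj_eqI)
    show "cycle_proj X iv c + cycle_proj X iv d \<in> cycles1 X iv"
      by (intro subspace_add[OF subspace_cycles1] cycle_proj_in_cycles1)
    fix w assume w: "w \<in> cycles1 X iv"
    show "chain_inner (c + d - (cycle_proj X iv c + cycle_proj X iv d)) w = 0"
      using cycle_proj_orthogonal[OF w, of c] cycle_proj_orthogonal[OF w, of d]
      by (simp add: chain_inner_simps)
  qed
  show "cycle_proj X iv (r *\<^sub>R c) = r *\<^sub>R cycle_proj X iv c"
  proof (rule cycle_proj_eqI)
    show "r *\<^sub>R cycle_proj X iv c \<in> cycles1 X iv"
      by (intro subspace_scale[OF subspace_cycles1] cycle_proj_in_cycles1)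
    fix w assume w: "w \<in> cycles1 X iv"
    show "chain_inner (r *\<^sub>R c - r *\<^sub>R cycle_proj X iv c) w = 0"
      using cycle_proj_orthogonal[OF w, of c]
      by (simp add: chain_inner_simps)
  qed
qed

end

section \<open>Automorphism groups\<close>

lemma graph_mapsD:
  assumes "\<phi> \<in> graph_maps X iv Y jv"
  shows "v \<in> verts X \<Longrightarrow> fst \<phi> v \<in> verts Y"
    and "e \<in> arcs X \<Longrightarrow> snd \<phi> e \<in> arcs Y"
    and "e \<in> arcs X \<Longrightarrow> tail Y (snd \<phi> e) = fst \<phi> (tail X e)"
    and "e \<in> arcs X \<Longrightarrow> head Y (snd \<phi> e) = fst \<phi> (head X e)"
    and "e \<in> arcs X \<Longrightarrow> snd \<phi> (iv e) = jv (snd \<phi> e)"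
  using assms by (auto simp: graph_maps_def)

lemma gm_comp_apply [simp]:
  "v \<in> verts X \<Longrightarrow> fst (gm_comp X \<psi> \<phi>) v = fst \<psi> (fst \<phi> v)"
  "e \<in> arcs X \<Longrightarrow> snd (gm_comp X \<psi> \<phi>) e = snd \<psi> (snd \<phi> e)"
  by (simp_all add: gm_comp_def compose_def)

lemma gm_comp_assoc:
  assumes "\<phi> \<in> graph_maps X iv Y jv"
  shows "gm_comp X (gm_comp Y \<theta> \<psi>) \<phi> = gm_comp X \<theta> (gm_comp X \<psi> \<phi>)"
  using graph_mapsD[OF assms] by (auto simp: gm_comp_def compose_def)

lemma gm_comp_closed:
  assumes "bidirected_digraph X iv" "\<phi> \<in> graph_maps X iv Y jv" "\<psi> \<in> graph_maps Y jv Z kv"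
  shows "gm_comp X \<psi> \<phi> \<in> graph_maps X iv Z kv"
proof -
  interpret bidirected_digraph X iv by fact
  show ?thesis
    using graph_mapsD[OF assms(2)] graph_mapsD[OF assms(3)]
    unfolding graph_maps_def by (auto simp: gm_comp_def compose_def)
qed

lemma graph_map_id: 
  assumes "bidirected_digraph X iv"
  shows "(\<lambda>v\<in>verts X. v, \<lambda>e\<in>arcs X. e) \<in> graph_maps X iv X iv"
proof -
  interpret bidirected_digraph X iv by fact
  show ?thesis by (auto simp: graph_maps_def)
qed

lemma gm_comp_id:
  assumes "\<phi> \<in> graph_maps X iv Y jv"
  shows "gm_comp X (\<lambda>v\<in>verts Y. v, \<lambda>e\<in>arcs Y. e) \<phi> = \<phi>"
    and "gm_comp X \<phi> (\<lambda>v\<in>verts X. v, \<lambda>e\<in>arcs X. e) = \<phi>"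
  using assms by (auto simp: graph_maps_def gm_comp_def compose_def PiE_def extensional_def
      Pi_iff prod_eq_iff fun_eq_iff)

lemma monoid_graph_End:
  assumes "bidirected_digraph X iv"
  shows "monoid (graph_End X iv)"
  by (rule monoidI)
    (auto simp: graph_End_def graph_map_id[OF assms] gm_comp_id
      intro: gm_comp_closed[OF assms] gm_comp_assoc)

lemma group_graph_Aut:
  assumes "bidirected_digraph X iv"
  shows "group (graph_Aut X iv)"
  unfolding graph_Aut_def by (rule monoid.units_group[OF monoid_graph_End[OF assms]])

lemma graph_Aut_simps:
  shows "carrier (graph_Aut X iv) \<subseteq> graph_maps X iv X iv"
    and "mult (graph_Aut X iv) = gm_comp X"
    and "one (graph_Aut X iv) = (\<lambda>v\<in>verts X. v, \<lambda>e\<in>arcs X. e)"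
  by (auto simp: graph_Aut_def units_of_def Units_def graph_End_def)

text \<open>
  The automorphisms of the cover that lie over some automorphism of the base are closed under the
  group operations: if \<open>q g = f q\<close>, then cancelling gives \<open>q g\<inverse> = f\<inverse> q\<close>.
\<close>

lemma group_Cov:
  assumes "bidirected_digraph X iv"
  shows "group (Cov X iv x0)"
proof -
  let ?C = "cover X iv x0" and ?I = "cover_inv X iv x0" and ?q = "covering_map X iv x0"
  let ?A = "graph_Aut ?C ?I" and ?B = "graph_Aut X iv"
  note C = cover_bidirected[OF assms, of x0] and q = covering_map_graph_map[OF assms, of x0]
  interpret A: group ?A by (rule group_graph_Aut[OF C])
  interpret B: group ?B by (rule group_graph_Aut[OF assms])
  let ?H = "{g \<in> carrier ?A. \<exists>f\<in>carrier ?B. gm_comp ?C ?q g = gm_comp ?C f ?q}"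
  have Amap: "g \<in> graph_maps ?C ?I ?C ?I" if "g \<in> carrier ?A" for g
    using that graph_Aut_simps(1) by blast
  have Bmap: "f \<in> graph_maps X iv X iv" if "f \<in> carrier ?B" for f
    using that graph_Aut_simps(1) by blast
  have "subgroup ?H ?A"
  proof (rule A.subgroupI)
    show "?H \<subseteq> carrier ?A" by blast
    have "\<one>\<^bsub>?A\<^esub> \<in> ?H"
      using A.one_closed B.one_closed gm_comp_id[OF q] by (force simp: graph_Aut_simps)
    then show "?H \<noteq> {}" by blast
  next
    fix g assume "g \<in> ?H"
    then obtain f where g: "g \<in> carrier ?A" and f: "f \<in> carrier ?B"
      and gf: "gm_comp ?C ?q g = gm_comp ?C f ?q" by blast
    let ?g = "inv\<^bsub>?A\<^esub> g" and ?f = "inv\<^bsub>?B\<^esub> f"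
    have g': "?g \<in> carrier ?A" and f': "?f \<in> carrier ?B" using g f by simp_all
    have gg: "gm_comp ?C g ?g = (\<lambda>v\<in>verts ?C. v, \<lambda>e\<in>arcs ?C. e)"
      using A.r_inv[OF g] by (simp add: graph_Aut_simps)
    have ff: "gm_comp X ?f f = (\<lambda>v\<in>verts X. v, \<lambda>e\<in>arcs X. e)"
      using B.l_inv[OF f] by (simp add: graph_Aut_simps)
    have "gm_comp ?C ?q ?g = gm_comp ?C (gm_comp ?C (gm_comp X ?f f) ?q) ?g"
      by (simp add: ff gm_comp_id(1)[OF q])
    also have "\<dots> = gm_comp ?C (gm_comp ?C ?f (gm_comp ?C f ?q)) ?g"
      by (simp only: gm_comp_assoc[OF q])
    also have "\<dots> = gm_comp ?C (gm_comp ?C (gm_comp ?C ?f ?q) g) ?g"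
      by (simp only: gf[symmetric] gm_comp_assoc[OF Amap[OF g]])
    also have "\<dots> = gm_comp ?C ?f (gm_comp ?C ?q (gm_comp ?C g ?g))"
      by (simp only: gm_comp_assoc[OF Amap[OF g']] gm_comp_assoc[OF Amap[OF g]])
    also have "\<dots> = gm_comp ?C ?f ?q" by (simp only: gg gm_comp_id(2)[OF q])
    finally show "?g \<in> ?H" using g' f' by blast
  next
    fix g h assume "g \<in> ?H" "h \<in> ?H"
    then obtain f k where g: "g \<in> carrier ?A" and f: "f \<in> carrier ?B"
      and gf: "gm_comp ?C ?q g = gm_comp ?C f ?q" and h: "h \<in> carrier ?A" and k: "k \<in> carrier ?B"
      and hk: "gm_comp ?C ?q h = gm_comp ?C k ?q" by blast
    have "gm_comp ?C ?q (gm_comp ?C g h) = gm_comp ?C (gm_comp ?C f ?q) h"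
      by (simp only: gf[symmetric] gm_comp_assoc[OF Amap[OF h]])
    also have "\<dots> = gm_comp ?C (gm_comp X f k) ?q"
      by (simp only: gm_comp_assoc[OF Amap[OF h]] gm_comp_assoc[OF q] hk)
    finally have "gm_comp ?C ?q (gm_comp ?C g h) = gm_comp ?C (gm_comp X f k) ?q" .
    then show "g \<otimes>\<^bsub>?A\<^esub> h \<in> ?H"
      using A.m_closed[OF g h] B.m_closed[OF f k] by (auto simp: graph_Aut_simps)
  qed
  then show ?thesis unfolding Cov_def by (rule A.subgroup_imp_group)
qed

lemma Cov_simps:
  shows "carrier (Cov X iv x0) \<subseteq>
      graph_maps (cover X iv x0) (cover_inv X iv x0) (cover X iv x0) (cover_inv X iv x0)"
    and "mult (Cov X iv x0) = gm_comp (cover X iv x0)"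
    and "one (Cov X iv x0) = (\<lambda>v\<in>verts (cover X iv x0). v, \<lambda>e\<in>arcs (cover X iv x0). e)"
proof -
  have "carrier (Cov X iv x0) \<subseteq> carrier (graph_Aut (cover X iv x0) (cover_inv X iv x0))"
    by (simp add: Cov_def)
  then show "carrier (Cov X iv x0) \<subseteq>
      graph_maps (cover X iv x0) (cover_inv X iv x0) (cover X iv x0) (cover_inv X iv x0)"
    using graph_Aut_simps(1) by blast
qed (simp_all add: Cov_def graph_Aut_simps)

section \<open>The extension to the geometric realization\<close>

text \<open>
  The extension of vertex values is built on points before gluing, where it is an explicit formula; it
  descends to the realization because reversing an edge swaps both its ends and the weights
  \<open>1 - t\<close> and \<open>t\<close>.
\<close>

definition vertex_interpolation ::
  "('a,'b) pre_digraph \<Rightarrow> ('a \<Rightarrow> 'w::real_vector) \<Rightarrow> 'a + 'b \<times> real \<Rightarrow> 'w" where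
  "vertex_interpolation Y h P = (case P of Inl v \<Rightarrow> h v
     | Inr (e, t) \<Rightarrow> (1 - t) *\<^sub>R h (tail Y e) + t *\<^sub>R h (head Y e))"

lemma vertex_interpolation_simps [simp]:
  "vertex_interpolation Y h (Inl v) = h v"
  "vertex_interpolation Y h (Inr (e, t)) = (1 - t) *\<^sub>R h (tail Y e) + t *\<^sub>R h (head Y e)"
  by (simp_all add: vertex_interpolation_def)

lemma vertex_interpolation_glue_class:
  assumes "bidirected_digraph Y iv" and "glue_class Y iv P = glue_class Y iv Q"
  shows "vertex_interpolation Y h P = vertex_interpolation Y h Q"
proof -
  interpret bidirected_digraph Y iv by fact
  have glue: "vertex_interpolation Y h P = vertex_interpolation Y h Q" if "glue Y iv P Q" for P Q
    using that by cases simp_all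
  have "equivclp (glue Y iv) P Q" using assms(2) by (simp add: glue_class_eq_iff)
  then show ?thesis by (induction rule: equivclp_induct) (auto dest: glue)
qed

lemma atom_cases:
  assumes "a \<in> atoms X iv x0"
  obtains p x where "a = path_class X iv x0 p" "pre_digraph.awalk X x0 p x"
  using assms by (auto simp: atoms_def)

lemma verts_cover: "verts (cover X iv x0) = atoms X iv x0"
  by (simp add: cover_def)

lemma tail_cover: "tail (cover X iv x0) d = fst d"
  by (simp add: cover_def)

context cycle_finite_graph
begin

lemma atom_map_in_cycles1: "a \<in> atoms X iv x0 \<Longrightarrow> atom_map X iv x0 a \<in> cycles1 X iv"
  by (auto simp: atoms_def atom_map_path_class[OF bidirected_digraph] intro: cycle_proj_in_cycles1)

lemma vertex_interpolation_atom_map_in_cycles1: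
  assumes "P \<in> prepoints (cover X iv x0)"
  shows "vertex_interpolation (cover X iv x0) (atom_map X iv x0) P \<in> cycles1 X iv"
proof -
  interpret C: bidirected_digraph "cover X iv x0" "cover_inv X iv x0"
    by (rule cover_bidirected[OF bidirected_digraph])
  have "atom_map X iv x0 (tail (cover X iv x0) d) \<in> cycles1 X iv"
    "atom_map X iv x0 (head (cover X iv x0) d) \<in> cycles1 X iv"
    if "d \<in> arcs (cover X iv x0)" for d
    using C.tail_in_verts[OF that] C.head_in_verts[OF that]
    by (simp_all add: verts_cover atom_map_in_cycles1)
  then show ?thesis
    using assms atom_map_in_cycles1
    by (auto simp: prepoints_def verts_cover
        intro!: subspace_add[OF subspace_cycles1] subspace_scale[OF subspace_cycles1])
qed

lemma is_affine_extension_unique: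
  assumes "is_affine_extension X iv x0 j" and "P \<in> prepoints (cover X iv x0)"
  shows "j (glue_class (cover X iv x0) (cover_inv X iv x0) P) =
    vertex_interpolation (cover X iv x0) (atom_map X iv x0) P"
proof -
  let ?C = "cover X iv x0" and ?I = "cover_inv X iv x0"
  interpret C: bidirected_digraph ?C ?I by (rule cover_bidirected[OF bidirected_digraph])
  have jv: "j (vertex_point ?C ?I v) = atom_map X iv x0 v" if "v \<in> verts ?C" for v
    using assms(1) that by (simp add: is_affine_extension_def verts_cover)
  show ?thesis
  proof (cases P)
    case (Inl v)
    then show ?thesis using assms(2) jv by (auto simp: prepoints_def)
  next
    case (Inr dt)
    obtain d t where P: "P = Inr (d, t)" using Inr by (cases dt) auto
    then have d: "d \<in> arcs ?C" and t: "t \<in> {0..1}" using assms(2) by (auto simp: prepoints_def)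
    obtain a b where ab: "\<And>t. t \<in> {0..1} \<Longrightarrow> j (bond ?C ?I d t) = a + t *\<^sub>R b"
      using assms(1) d by (auto simp: is_affine_extension_def affine_on_bonds_def)
    have "a = atom_map X iv x0 (tail ?C d)"
      using ab[of 0] jv C.tail_in_verts[OF d] bond_ends(1)[OF d] by simp
    moreover have b: "a + b = atom_map X iv x0 (head ?C d)"
      using ab[of 1] jv C.head_in_verts[OF d] bond_ends(2)[OF d] by simp
    ultimately have "a + t *\<^sub>R b =
        (1 - t) *\<^sub>R atom_map X iv x0 (tail ?C d) + t *\<^sub>R atom_map X iv x0 (head ?C d)"
      by (simp add: algebra_simps flip: b)
    then show ?thesis using ab[OF t] by (simp add: P)
  qed
qed

lemma is_affine_extension_exists: "\<exists>j. is_affine_extension X iv x0 j"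
proof
  let ?C = "cover X iv x0" and ?I = "cover_inv X iv x0"
  let ?J = "vertex_interpolation ?C (atom_map X iv x0)"
  let ?j = "\<lambda>c\<in>topspace (geometric_realization ?C ?I). ?J (SOME P. P \<in> prepoints ?C \<and> c = glue_class ?C ?I P)"
  note C = cover_bidirected[OF bidirected_digraph, of x0]
  interpret C: bidirected_digraph ?C ?I by (rule C)
  have j: "?j (glue_class ?C ?I P) = ?J P" if P: "P \<in> prepoints ?C" for P
  proof -
    let ?Q = "SOME Q. Q \<in> prepoints ?C \<and> glue_class ?C ?I P = glue_class ?C ?I Q"
    have "glue_class ?C ?I P = glue_class ?C ?I ?Q"
      using someI[of "\<lambda>Q. Q \<in> prepoints ?C \<and> glue_class ?C ?I P = glue_class ?C ?I Q" P] P by simp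
    from vertex_interpolation_glue_class[OF C this] have "?J ?Q = ?J P" by (rule sym)
    then show ?thesis using P by (simp add: topspace_geometric_realization)
  qed
  show "is_affine_extension X iv x0 ?j"
    unfolding is_affine_extension_def affine_on_bonds_def
  proof (intro conjI ballI)
    have "?j c \<in> cycles1 X iv" if "c \<in> topspace (geometric_realization ?C ?I)" for c
    proof -
      obtain P where P: "P \<in> prepoints ?C" "c = glue_class ?C ?I P"
        using \<open>c \<in> _\<close> by (auto simp: topspace_geometric_realization)
      show ?thesis unfolding P(2) j[OF P(1)] by (rule vertex_interpolation_atom_map_in_cycles1[OF P(1)])
    qed
    then show "?j \<in> topspace (geometric_realization ?C ?I) \<rightarrow>\<^sub>E cycles1 X iv"
      by (rule PiE_I) simp_all
  next
    fix a assume "a \<in> atoms X iv x0"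
    then have "Inl a \<in> prepoints ?C" by (simp add: prepoints_def verts_cover)
    from j[OF this] show "?j (vertex_point ?C ?I a) = atom_map X iv x0 a" by simp
  next
    fix d assume d: "d \<in> arcs ?C"
    let ?a = "atom_map X iv x0 (tail ?C d)" and ?b = "atom_map X iv x0 (head ?C d)"
    have ab: "?a \<in> cycles1 X iv" "?b \<in> cycles1 X iv"
      using C.tail_in_verts[OF d] C.head_in_verts[OF d]
      by (simp_all add: verts_cover atom_map_in_cycles1)
    have "?j (bond ?C ?I d t) = ?a + t *\<^sub>R (?b - ?a)" if "t \<in> {0..1}" for t
    proof -
      have "Inr (d, t) \<in> prepoints ?C" using d that by (auto simp: prepoints_def)
      from j[OF this] show ?thesis by (simp add: algebra_simps)
    qed
    moreover have "?b - ?a \<in> cycles1 X iv" using ab subspace_cycles1 subspace_diff by blast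
    ultimately show "\<exists>a\<in>cycles1 X iv. \<exists>b\<in>cycles1 X iv. \<forall>t\<in>{0..1}. ?j (bond ?C ?I d t) = a + t *\<^sub>R b"
      using ab(1) by blast
  qed
qed

lemma realization_embedding_glue_class:
  assumes "P \<in> prepoints (cover X iv x0)"
  shows "realization_embedding X iv x0 (glue_class (cover X iv x0) (cover_inv X iv x0) P) =
    vertex_interpolation (cover X iv x0) (atom_map X iv x0) P"
proof -
  have "\<exists>!j. is_affine_extension X iv x0 j"
  proof (rule ex_ex1I[OF is_affine_extension_exists])
    fix j k assume jk: "is_affine_extension X iv x0 j" "is_affine_extension X iv x0 k"
    let ?T = "topspace (geometric_realization (cover X iv x0) (cover_inv X iv x0))"
    show "j = k"
    proof (rule extensionalityI[of _ ?T])
      show "j \<in> extensional ?T" "k \<in> extensional ?T"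
        using jk by (auto simp: is_affine_extension_def PiE_def)
      show "j c = k c" if "c \<in> ?T" for c
        using that is_affine_extension_unique[OF jk(1)] is_affine_extension_unique[OF jk(2)]
        by (auto simp: topspace_geometric_realization)
    qed
  qed
  from theI'[OF this] show ?thesis
    unfolding realization_embedding_def using is_affine_extension_unique assms by blast
qed

end

section \<open>Chains under automorphisms\<close>

definition pushforward :: "('b \<Rightarrow> 'b) \<Rightarrow> ('a \<Rightarrow> 'a) \<times> ('b \<Rightarrow> 'b) \<Rightarrow> ('b \<Rightarrow>\<^sub>0 real) \<Rightarrow> ('b \<Rightarrow>\<^sub>0 real)" where
  "pushforward iv f = chain_lift (\<lambda>e. edge_chain iv (snd f e))"

lemma linear_pushforward: "linear (pushforward iv f)"
  unfolding pushforward_def by (rule linear_chain_lift)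

context bidirected_digraph
begin

lemma pushforward_edge_chain:
  assumes "f \<in> graph_maps G arev G arev" and "e \<in> arcs G"
  shows "pushforward arev f (edge_chain arev e) = edge_chain arev (snd f e)"
  unfolding pushforward_def
  using graph_mapsD(5)[OF assms] edge_chain_inverse[OF bidirected_digraph]
  by (intro chain_lift_edge_chain[OF bidirected_digraph assms(2)]) simp

lemma pushforward_path_chain:
  assumes "f \<in> graph_maps G arev G arev" and "set p \<subseteq> arcs G"
  shows "pushforward arev f (path_chain arev p) = path_chain arev (map (snd f) p)"
  using assms(2)
  by (induction p)
    (simp_all add: path_chain_def pushforward_edge_chain[OF assms(1)]
      linear_0[OF linear_pushforward] linear_add[OF linear_pushforward])

lemma linear_eq_on_chains1:
  assumes "linear L" "linear M"
    and "\<And>e. e \<in> arcs G \<Longrightarrow> L (edge_chain arev e) = M (edge_chain arev e)"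
    and "c \<in> chains1 G arev"
  shows "L c = M c"
  using linear_eq_on[OF assms(1,2), of c "edge_chain arev ` arcs G"] assms(3,4)
    chains1_eq_span[OF bidirected_digraph] by auto

lemma pushforward_in_chains1:
  assumes f: "f \<in> graph_maps G arev G arev" and c: "c \<in> chains1 G arev"
  shows "pushforward arev f c \<in> chains1 G arev"
proof -
  have "pushforward arev f ` chains1 G arev
      = span (pushforward arev f ` edge_chain arev ` arcs G)"
    by (simp add: chains1_eq_span[OF bidirected_digraph] linear_span_image[OF linear_pushforward])
  also have "\<dots> \<subseteq> span (edge_chain arev ` arcs G)"
    using graph_mapsD(2)[OF f] by (intro span_mono) (auto simp: pushforward_edge_chain[OF f])
  finally show ?thesis using c chains1_eq_span[OF bidirected_digraph] by blast
qed

text \<open>The boundary commutes with the maps that \<open>f\<close> induces on \<open>1\<close>-chains and on \<open>0\<close>-chains.\<close>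

lemma pushforward_in_cycles1:
  assumes f: "f \<in> graph_maps G arev G arev" and c: "c \<in> cycles1 G arev"
  shows "pushforward arev f c \<in> cycles1 G arev"
proof -
  \<comment> \<open>The map induced on \<open>0\<close>-chains; the factor cancels the \<open>1/2\<close> in the definition of \<open>chain_lift\<close>.\<close>
  define F where "F = chain_lift (\<lambda>v. Poly_Mapping.single (fst f v) (2::real))"
  have linF: "linear F" unfolding F_def by (rule linear_chain_lift)
  have F_single: "F (Poly_Mapping.single v 1) = Poly_Mapping.single (fst f v) 1" for v
    by (rule poly_mapping_eqI)
      (simp add: F_def chain_lift_def lookup_scaleR_chain lookup_single when_def)
  have linB: "linear (chain_boundary G)" unfolding chain_boundary_def by (rule linear_chain_lift)
  have "(chain_boundary G \<circ> pushforward arev f) c = (F \<circ> chain_boundary G) c"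
  proof (rule linear_eq_on_chains1)
    show "linear (chain_boundary G \<circ> pushforward arev f)" "linear (F \<circ> chain_boundary G)"
      using linF linB linear_pushforward by (blast intro: linear_compose)+
    show "c \<in> chains1 G arev" using c by (simp add: cycles1_def)
    fix e assume e: "e \<in> arcs G"
    show "(chain_boundary G \<circ> pushforward arev f) (edge_chain arev e) =
        (F \<circ> chain_boundary G) (edge_chain arev e)"
      using graph_mapsD(2-4)[OF f e]
      by (simp add: pushforward_edge_chain[OF f e] chain_boundary_edge_chain[OF bidirected_digraph]
          e linear_diff[OF linF] F_single)
  qed
  then have "chain_boundary G (pushforward arev f c) = 0"
    using c by (simp add: cycles1_def linear_0[OF linF])
  then show ?thesis using c pushforward_in_chains1[OF f, of c] by (simp add: cycles1_def)
qed

text \<open>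
  Edges form an orthonormal basis up to sign, and an injective graph map sends distinct pairs
  \<open>e\<close>, \<open>e\<inverse>\<close> to distinct pairs.  The equality on pairs of edges extends by linearity, one argument
  at a time.
\<close>

lemma chain_inner_pushforward:
  assumes f: "f \<in> graph_maps G arev G arev" and inj: "inj_on (snd f) (arcs G)"
    and c: "c \<in> chains1 G arev" and d: "d \<in> chains1 G arev"
  shows "chain_inner (pushforward arev f c) (pushforward arev f d) = chain_inner c d"
proof -
  let ?F = "pushforward arev f"
  have edges: "chain_inner (?F (edge_chain arev e)) (?F (edge_chain arev e')) =
      chain_inner (edge_chain arev e) (edge_chain arev e')" 
    if "e \<in> arcs G" "e' \<in> arcs G" for e e'
  proof -
    have "snd f e' = snd f e \<longleftrightarrow> e' = e" using inj that by (auto dest: inj_onD)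
    moreover have "snd f e' = arev (snd f e) \<longleftrightarrow> e' = arev e"
      using inj that graph_mapsD(5)[OF f that(1)] by (metis arev_in_arcs inj_onD)
    ultimately show ?thesis
      using that graph_mapsD(2)[OF f]
      by (simp add: pushforward_edge_chain[OF f] chain_inner_edge_chain(2)[OF bidirected_digraph])
  qed
  have right: "chain_inner (?F (edge_chain arev e)) (?F d) = chain_inner (edge_chain arev e) d"
    if e: "e \<in> arcs G" for e
  proof -
    have "(chain_inner (?F (edge_chain arev e)) \<circ> ?F) d = chain_inner (edge_chain arev e) d"
      by (rule linear_eq_on_chains1[OF linear_compose[OF linear_pushforward linear_chain_inner_right]
            linear_chain_inner_right _ d]) (simp add: edges[OF e])
    then show ?thesis by simp
  qed
  have "((\<lambda>x. chain_inner x (?F d)) \<circ> ?F) c = chain_inner c d"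
    by (rule linear_eq_on_chains1[OF linear_compose[OF linear_pushforward linear_chain_inner_left]
          linear_chain_inner_left _ c]) (simp add: right)
  then show ?thesis by simp
qed

end

text \<open>
  An isometry that maps cycles onto cycles also preserves the orthogonal complement of the cycles.
  Invertibility of \<open>f\<close> is what makes every cycle an image of a cycle.
\<close>

lemma (in cycle_finite_graph) cycle_proj_pushforward:
  assumes f: "f \<in> carrier (graph_Aut X iv)" and c: "c \<in> chains1 X iv"
  shows "cycle_proj X iv (pushforward iv f c) = pushforward iv f (cycle_proj X iv c)"
proof (rule cycle_proj_eqI)
  interpret A: group "graph_Aut X iv" by (rule group_graph_Aut[OF bidirected_digraph])
  let ?f = "inv\<^bsub>graph_Aut X iv\<^esub> f"
  have fm: "f \<in> graph_maps X iv X iv" and fm': "?f \<in> graph_maps X iv X iv"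
    using f A.inv_closed[OF f] graph_Aut_simps(1) by blast+
  have id: "gm_comp X f ?f = (\<lambda>v\<in>verts X. v, \<lambda>e\<in>arcs X. e)"
    "gm_comp X ?f f = (\<lambda>v\<in>verts X. v, \<lambda>e\<in>arcs X. e)"
    using A.r_inv[OF f] A.l_inv[OF f] by (simp_all add: graph_Aut_simps)
  have left: "snd ?f (snd f e) = e" and right: "snd f (snd ?f e) = e" if "e \<in> arcs X" for e
    using that arg_cong[OF id(1), of "\<lambda>g. snd g e"] arg_cong[OF id(2), of "\<lambda>g. snd g e"] by simp_all
  have inj: "inj_on (snd f) (arcs X)" using left by (rule inj_on_inverseI)
  show "pushforward iv f (cycle_proj X iv c) \<in> cycles1 X iv"
    using pushforward_in_cycles1[OF fm] cycle_proj_in_cycles1 by blast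
  fix w assume w: "w \<in> cycles1 X iv"
  let ?w = "pushforward iv ?f w"
  have w': "?w \<in> cycles1 X iv" using pushforward_in_cycles1[OF fm' w] .
  have "(pushforward iv f \<circ> pushforward iv ?f) w = (\<lambda>x. x) w"
  proof (rule linear_eq_on_chains1[where L = "pushforward iv f \<circ> pushforward iv ?f" and M = "\<lambda>x. x"])
    show "linear (pushforward iv f \<circ> pushforward iv ?f)"
      using linear_pushforward by (blast intro: linear_compose)
    show "(pushforward iv f \<circ> pushforward iv ?f) (edge_chain iv e) = edge_chain iv e"
      if "e \<in> arcs X" for e
      using that graph_mapsD(2)[OF fm' that] right
      by (simp add: pushforward_edge_chain[OF fm] pushforward_edge_chain[OF fm'])
  qed (use w in \<open>simp_all add: cycles1_def linear_ident\<close>)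
  then have "chain_inner (pushforward iv f c - pushforward iv f (cycle_proj X iv c)) w
      = chain_inner (pushforward iv f (c - cycle_proj X iv c)) (pushforward iv f ?w)"
    by (simp add: linear_diff[OF linear_pushforward])
  also have "\<dots> = chain_inner (c - cycle_proj X iv c) ?w"
    using c cycle_proj_in_cycles1[of c] w'
    by (intro chain_inner_pushforward[OF fm inj] subspace_diff[OF subspace_chains1])
      (simp_all add: cycles1_def)
  also have "\<dots> = 0" by (rule cycle_proj_orthogonal[OF w'])
  finally show "chain_inner (pushforward iv f c - pushforward iv f (cycle_proj X iv c)) w = 0" .
qed

section \<open>The affine action on cycles\<close>

locale based_cycle_finite_graph = cycle_finite_graph X iv
  for X :: "('a,'b) pre_digraph" and iv :: "'b \<Rightarrow> 'b" +
  fixes x0 :: 'a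
  assumes connected_X: "Digraph_Component.connected X"
    and basepoint: "x0 \<in> verts X"
begin

abbreviation "C \<equiv> cover X iv x0"
abbreviation "I \<equiv> cover_inv X iv x0"
abbreviation "Z \<equiv> cycles1 X iv"
abbreviation "\<pi> \<equiv> cycle_proj X iv"
abbreviation "i \<equiv> atom_map X iv x0"
abbreviation "A \<equiv> atoms X iv x0"
abbreviation "cls \<equiv> path_class X iv x0"

lemma path_from_basepoint: "v \<in> verts X \<Longrightarrow> \<exists>p. awalk x0 p v"
proof -
  assume "v \<in> verts X"
  then have "x0 \<rightarrow>\<^sup>*\<^bsub>mk_symmetric X\<^esub> v"
    using connected_X basepoint
    unfolding Digraph_Component.connected_def strongly_connected_def by simp
  then have "x0 \<rightarrow>\<^sup>*\<^bsub>X\<^esub> v" using reachable_mk_symmetric_eq[OF sym_arcs] by simp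
  then show ?thesis by (simp add: reachable_awalk)
qed

lemma awalk_snoc: "awalk x0 p (tail X e) \<Longrightarrow> e \<in> arcs X \<Longrightarrow> awalk x0 (p @ [e]) (head X e)"
  using awalk_appendI[of x0 p "tail X e" "[e]"] by (simp add: arc_implies_awalk del: awalk_append_iff)

lemma atom_map_path: "i (cls p) = \<pi> (path_chain iv p)"
  by (rule atom_map_path_class[OF bidirected_digraph])

lemma trivial_atom: "cls [] \<in> A" and atom_map_trivial: "i (cls []) = 0"
  using basepoint linear_0[OF linear_cycle_proj]
  by (auto simp: atom_map_path path_chain_def awalk_Nil_iff intro: atomsI[of X x0 "[]" x0])

text \<open>
  Appending an edge \<open>e\<close> to a path changes its image by \<open>\<pi> e\<close>, and connectedness provides a path to the
  source of every edge.  So the span contains the image of \<open>\<pi>\<close>, which is the whole space of cycles.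
\<close>

lemma span_atom_map: "span (i ` A) = Z"
proof
  show "span (i ` A) \<subseteq> Z"
    by (rule span_minimal) (auto intro: atom_map_in_cycles1 subspace_cycles1)
  have "\<pi> (edge_chain iv e) \<in> span (i ` A)" if e: "e \<in> arcs X" for e
  proof -
    obtain p where p: "awalk x0 p (tail X e)" using path_from_basepoint[OF tail_in_verts[OF e]] by blast
    have "\<pi> (edge_chain iv e) = i (cls (p @ [e])) - i (cls p)"
      by (simp add: atom_map_path path_chain_def linear_add[OF linear_cycle_proj])
    moreover have "cls (p @ [e]) \<in> A" "cls p \<in> A" using awalk_snoc[OF p e] p by (blast intro: atomsI)+
    ultimately show ?thesis by (simp add: span_base span_diff)
  qed
  then have "\<pi> ` span (edge_chain iv ` arcs X) \<subseteq> span (i ` A)"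
    unfolding linear_span_image[OF linear_cycle_proj, symmetric]
    by (intro span_minimal) auto
  then have "\<pi> ` chains1 X iv \<subseteq> span (i ` A)" by (simp add: chains1_eq_span[OF bidirected_digraph])
  moreover have "z \<in> chains1 X iv \<and> \<pi> z = z" if "z \<in> Z" for z
    using that by (simp add: cycle_proj_cycle) (simp add: cycles1_def)
  ultimately show "Z \<subseteq> span (i ` A)" by (metis image_subset_iff subsetI)
qed

text \<open>
  The trivial atom lies at \<open>0\<close>, which forces the translation parts to agree; the linear parts then
  agree on a spanning set.
\<close>

lemma affine_eq_on_atoms:
  assumes "linear L" "linear M" and eq: "\<And>a. a \<in> A \<Longrightarrow> L (i a) + b = M (i a) + c" and "z \<in> Z"
  shows "L z + b = M z + c"
proof -
  have bc: "b = c"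
    using eq[OF trivial_atom] by (simp add: atom_map_trivial linear_0 assms(1,2))
  have "L z = M z"
    by (rule linear_eq_on[OF assms(1,2), of z "i ` A"])
      (use eq bc span_atom_map assms(4) in auto)
  then show ?thesis by (simp add: bc)
qed

text \<open>
  Unique path lifting: the edges of the cover issuing from an atom are told apart by the edges of
  \<open>X\<close> below them, so \<open>g\<close> is determined by \<open>f\<close> and by the image of the trivial atom, edge by edge
  along a path.
\<close>

lemma Cov_path_class:
  assumes g: "g \<in> carrier (Cov X iv x0)"
  obtains f p where "f \<in> carrier (graph_Aut X iv)" and "awalk x0 p (fst f x0)"
    and "\<And>r x. awalk x0 r x \<Longrightarrow> fst g (cls r) = cls (p @ map (snd f) r)"
proof -
  obtain f where f: "f \<in> carrier (graph_Aut X iv)"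
    and gf: "gm_comp C (covering_map X iv x0) g = gm_comp C f (covering_map X iv x0)"
    using g by (auto simp: Cov_def)
  have gm: "g \<in> graph_maps C I C I" by (rule subsetD[OF Cov_simps(1) g])
  have fm: "f \<in> graph_maps X iv X iv" using f graph_Aut_simps(1) by blast
  have V: "fst (covering_map X iv x0) (fst g a) = fst f (fst (covering_map X iv x0) a)" if "a \<in> A" for a
    using arg_cong[OF gf, of "\<lambda>h. fst h a"] that by (simp add: verts_cover)
  have E: "snd (snd g d) = snd f (snd d)" if "d \<in> arcs C" for d
    using arg_cong[OF gf, of "\<lambda>h. snd h d"] that graph_mapsD(2)[OF gm that]
    by (simp add: covering_map_def)
  have "fst g (cls []) \<in> A" using graph_mapsD(1)[OF gm] trivial_atom by (simp add: verts_cover)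
  then obtain p y where p: "fst g (cls []) = cls p" "awalk x0 p y" by (rule atom_cases)
  have "awalk x0 [] x0" using basepoint by (simp add: awalk_Nil_iff)
  then have y: "y = fst f x0"
    using V[OF trivial_atom] p(1) covering_map_atom[OF bidirected_digraph p(2)]
      covering_map_atom[OF bidirected_digraph, of x0 "[]" x0] by simp
  have "fst g (cls r) = cls (p @ map (snd f) r) \<and> awalk x0 (p @ map (snd f) r) (fst f x)"
    if "awalk x0 r x" for r x
    using that
  proof (induction r arbitrary: x rule: rev_induct)
    case Nil
    then show ?case using p y by (auto simp: awalk_Nil_iff)
  next
    case (snoc e r)
    then have r: "awalk x0 r (tail X e)" and e: "e \<in> arcs X" and x: "x = head X e"
      by (auto simp: awalk_simps)
    let ?d = "(cls r, e)"
    let ?r = "p @ map (snd f) r"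
    have IH: "fst g (cls r) = cls ?r" "awalk x0 ?r (tail X (snd f e))"
      using snoc.IH[OF r] graph_mapsD(3)[OF fm e] by simp_all
    have fe: "snd f e \<in> arcs X" using graph_mapsD(2)[OF fm e] .
    have d: "?d \<in> arcs C" using r e by (auto simp: cover_def)
    have gd: "snd g ?d = (cls ?r, snd f e)"
      using E[OF d] graph_mapsD(3)[OF gm d] IH(1) by (simp add: tail_cover prod_eq_iff)
    have "fst g (cls (r @ [e])) = head C (snd g ?d)"
      using graph_mapsD(4)[OF gm d] cover_head[OF bidirected_digraph r e] by simp
    also have "\<dots> = cls (?r @ [snd f e])"
      unfolding gd by (rule cover_head[OF bidirected_digraph IH(2) fe])
    finally show ?case using awalk_snoc[OF IH(2) fe] graph_mapsD(4)[OF fm e] x by simp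
  qed
  then show ?thesis using that[OF f, of p] p y by blast
qed

text \<open>
  The linear part is the action of \<open>f\<close> on chains; the translation is the image of a path \<open>p\<close> that
  represents the value of \<open>g\<close> at the trivial atom.
\<close>

lemma Cov_affine:
  assumes g: "g \<in> carrier (Cov X iv x0)"
  shows "\<exists>L b. linear L \<and> (\<forall>z\<in>Z. L z + b \<in> Z) \<and> (\<forall>a\<in>A. i (fst g a) = L (i a) + b)"
proof -
  obtain f p where f: "f \<in> carrier (graph_Aut X iv)"
    and g_cls: "\<And>r x. awalk x0 r x \<Longrightarrow> fst g (cls r) = cls (p @ map (snd f) r)"
    using Cov_path_class[OF g] by metis
  have fm: "f \<in> graph_maps X iv X iv" using f graph_Aut_simps(1) by blast
  have "i (fst g a) = pushforward iv f (i a) + \<pi> (path_chain iv p)" if a: "a \<in> A" for a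
  proof -
    obtain r x where r: "a = cls r" "awalk x0 r x" using a by (rule atom_cases)
    then have arcs: "set r \<subseteq> arcs X" by auto
    have chain: "path_chain iv r \<in> chains1 X iv"
      unfolding path_chain_def using arcs
      by (induction r)
        (auto intro!: subspace_add[OF subspace_chains1] subspace_0[OF subspace_chains1]
          edge_chain_in_chains1[OF bidirected_digraph])
    have "i (fst g a) = \<pi> (path_chain iv (map (snd f) r)) + \<pi> (path_chain iv p)"
      using g_cls[OF r(2)]
      by (simp add: r(1) atom_map_path path_chain_def linear_add[OF linear_cycle_proj])
    also have "\<pi> (path_chain iv (map (snd f) r)) = pushforward iv f (i a)"
      using cycle_proj_pushforward[OF f chain] pushforward_path_chain[OF fm arcs]
      by (simp add: r(1) atom_map_path)
    finally show ?thesis .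
  qed
  moreover have "pushforward iv f z + \<pi> (path_chain iv p) \<in> Z" if "z \<in> Z" for z
    using that by (intro subspace_add[OF subspace_cycles1] pushforward_in_cycles1[OF fm] cycle_proj_in_cycles1)
  ultimately show ?thesis using linear_pushforward by blast
qed

text \<open>
  The affine maps attached to the elements of the group are picked independently of each other.
  They nevertheless satisfy the laws of an action, because both sides of each law are affine and
  agree at the atoms, where the law says that the group acts on the atoms.  Bijectivity follows from
  these laws applied to \<open>g\<close> and \<open>g\<inverse>\<close>.
\<close>

lemma is_affine_Cov_action_exists: "\<exists>\<rho>. is_affine_Cov_action X iv x0 \<rho>"
proof -
  let ?G = "Cov X iv x0"
  interpret G: group ?G by (rule group_Cov[OF bidirected_digraph])
  obtain L b where lin: "\<And>g. g \<in> carrier ?G \<Longrightarrow> linear (L g)"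
    and closed: "\<And>g z. g \<in> carrier ?G \<Longrightarrow> z \<in> Z \<Longrightarrow> L g z + b g \<in> Z"
    and atom: "\<And>g a. g \<in> carrier ?G \<Longrightarrow> a \<in> A \<Longrightarrow> i (fst g a) = L g (i a) + b g"
    using Cov_affine by metis
  define T where "T g = (\<lambda>z\<in>Z. L g z + b g)" for g
  have A_closed: "fst g a \<in> A" if "g \<in> carrier ?G" "a \<in> A" for g a
    using graph_mapsD(1)[OF subsetD[OF Cov_simps(1) that(1)], of a] that(2) by (simp add: verts_cover)
  have T_one: "T \<one>\<^bsub>?G\<^esub> = (\<lambda>z\<in>Z. z)"
  proof -
    have "L \<one>\<^bsub>?G\<^esub> z + b \<one>\<^bsub>?G\<^esub> = id z + 0" if "z \<in> Z" for z
      using lin[OF G.one_closed] linear_id _ that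
    proof (rule affine_eq_on_atoms)
      show "L \<one>\<^bsub>?G\<^esub> (i a) + b \<one>\<^bsub>?G\<^esub> = id (i a) + 0" if "a \<in> A" for a
        using atom[OF G.one_closed that] that by (simp add: Cov_simps verts_cover)
    qed
    then show ?thesis by (auto simp: T_def)
  qed
  have T_mult: "T (g \<otimes>\<^bsub>?G\<^esub> h) = compose Z (T g) (T h)"
    if g: "g \<in> carrier ?G" and h: "h \<in> carrier ?G" for g h
  proof -
    have "L (g \<otimes>\<^bsub>?G\<^esub> h) z + b (g \<otimes>\<^bsub>?G\<^esub> h) = (L g \<circ> L h) z + (L g (b h) + b g)" if "z \<in> Z" for z
      using lin[OF G.m_closed[OF g h]] linear_compose[OF lin[OF h] lin[OF g]] _ that
    proof (rule affine_eq_on_atoms)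
      fix a assume a: "a \<in> A"
      have "L (g \<otimes>\<^bsub>?G\<^esub> h) (i a) + b (g \<otimes>\<^bsub>?G\<^esub> h) = i (fst g (fst h a))"
        using atom[OF G.m_closed[OF g h] a] a by (simp add: Cov_simps verts_cover)
      also have "\<dots> = L g (L h (i a) + b h) + b g"
        by (simp add: atom[OF g A_closed[OF h a]] atom[OF h a])
      finally show "L (g \<otimes>\<^bsub>?G\<^esub> h) (i a) + b (g \<otimes>\<^bsub>?G\<^esub> h) = (L g \<circ> L h) (i a) + (L g (b h) + b g)"
        by (simp add: linear_add[OF lin[OF g]])
    qed
    then show ?thesis
      using closed[OF h] by (auto simp: T_def compose_def linear_add[OF lin[OF g]])
  qed
  have T_Bij: "T g \<in> Bij Z" if g: "g \<in> carrier ?G" for g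
  proof -
    let ?g = "inv\<^bsub>?G\<^esub> g"
    have g': "?g \<in> carrier ?G" using g by simp
    have inv: "T ?g (T g z) = z" "T g (T ?g z) = z" if "z \<in> Z" for z
      using fun_cong[OF T_mult[OF g' g], of z] fun_cong[OF T_mult[OF g g'], of z] that
      by (simp_all add: G.l_inv[OF g] G.r_inv[OF g] T_one compose_eq)
    have T_closed: "T h z \<in> Z" if "h \<in> carrier ?G" "z \<in> Z" for h z
      using closed[OF that] that(2) by (simp add: T_def)
    then have "bij_betw (T g) Z Z"
      by (intro bij_betw_byWitness[where f' = "T ?g"])
        (simp_all add: inv image_subset_iff T_closed[OF g] T_closed[OF g'])
    then show ?thesis by (simp add: Bij_def T_def)
  qed
  let ?\<rho> = "restrict T (carrier ?G)"
  have "?\<rho> \<in> hom ?G (BijGroup Z)"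
    by (rule homI) (simp_all add: T_Bij T_mult BijGroup_def)
  then have "group_action ?G Z ?\<rho>"
    unfolding group_action_def group_hom_def group_hom_axioms_def
    using G.is_group group_BijGroup by blast
  moreover have "affine_transformation Z (?\<rho> g)" if g: "g \<in> carrier ?G" for g
  proof -
    have "\<forall>z\<in>Z. T g z = L g z + b g" by (simp add: T_def)
    then show ?thesis using T_Bij[OF g] lin[OF g] g unfolding affine_transformation_def by auto
  qed
  moreover have "?\<rho> g (i a) = i (fst g a)" if "g \<in> carrier ?G" "a \<in> A" for g a
    using that atom_map_in_cycles1 by (simp add: T_def atom)
  ultimately have "is_affine_Cov_action X iv x0 ?\<rho>"
    by (simp add: is_affine_Cov_action_def)
  then show ?thesis by - (rule exI)
qed

lemma is_affine_Cov_action_affine_Cov_action: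
  "is_affine_Cov_action X iv x0 (affine_Cov_action X iv x0)"
proof -
  have "\<exists>!\<rho>. is_affine_Cov_action X iv x0 \<rho>"
  proof (rule ex_ex1I[OF is_affine_Cov_action_exists])
    fix \<rho> \<sigma> assume \<rho>\<sigma>: "is_affine_Cov_action X iv x0 \<rho>" "is_affine_Cov_action X iv x0 \<sigma>"
    show "\<rho> = \<sigma>"
    proof (rule extensionalityI[of _ "carrier (Cov X iv x0)"])
      show "\<rho> \<in> extensional (carrier (Cov X iv x0))" "\<sigma> \<in> extensional (carrier (Cov X iv x0))"
        using \<rho>\<sigma> by (auto simp: is_affine_Cov_action_def)
      fix g assume g: "g \<in> carrier (Cov X iv x0)"
      have aff: "affine_transformation Z (\<rho> g)" "affine_transformation Z (\<sigma> g)"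
        using \<rho>\<sigma> g by (auto simp: is_affine_Cov_action_def)
      obtain L b where L: "linear L" "\<And>z. z \<in> Z \<Longrightarrow> \<rho> g z = L z + b"
        using aff(1) by (auto simp: affine_transformation_def)
      obtain M c where M: "linear M" "\<And>z. z \<in> Z \<Longrightarrow> \<sigma> g z = M z + c"
        using aff(2) by (auto simp: affine_transformation_def)
      have eq: "L (i a) + b = M (i a) + c" if a: "a \<in> A" for a
      proof -
        have "\<rho> g (i a) = \<sigma> g (i a)" using \<rho>\<sigma> g a by (simp add: is_affine_Cov_action_def)
        then show ?thesis using atom_map_in_cycles1[OF a] by (simp add: L(2) M(2))
      qed
      show "\<rho> g = \<sigma> g"
      proof (rule extensionalityI[of _ Z])
        show "\<rho> g \<in> extensional Z" "\<sigma> g \<in> extensional Z"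
          using aff by (auto simp: affine_transformation_def Bij_def)
        show "\<rho> g z = \<sigma> g z" if "z \<in> Z" for z
          using affine_eq_on_atoms[OF L(1) M(1) eq that] L(2) M(2) that by simp
      qed
    qed
  qed
  from theI'[OF this] show ?thesis unfolding affine_Cov_action_def .
qed

lemma realization_embedding_equivariant:
  assumes g: "g \<in> carrier (Cov X iv x0)"
    and p: "p \<in> topspace (geometric_realization C I)"
  shows "affine_Cov_action X iv x0 g (realization_embedding X iv x0 p) =
      realization_embedding X iv x0 (realization_map C I g p)"
proof -
  interpret C: bidirected_digraph C I by (rule cover_bidirected[OF bidirected_digraph])
  let ?T = "affine_Cov_action X iv x0 g"
  have gm: "g \<in> graph_maps C I C I" by (rule subsetD[OF Cov_simps(1) g])
  obtain L b where L: "linear L" "\<And>z. z \<in> Z \<Longrightarrow> ?T z = L z + b"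
    and T_atom: "\<And>a. a \<in> A \<Longrightarrow> ?T (i a) = i (fst g a)"
    using is_affine_Cov_action_affine_Cov_action g
    by (auto simp: is_affine_Cov_action_def affine_transformation_def)
  obtain P where P: "P \<in> prepoints C" "p = glue_class C I P"
    using p by (auto simp: topspace_geometric_realization)
  let ?P = "map_sum (fst g) (map_prod (snd g) id) P"
  have gP: "?P \<in> prepoints C"
    using P(1) graph_mapsD(1,2)[OF gm] by (auto simp: prepoints_def)
  have "?T (vertex_interpolation C i P) = vertex_interpolation C i ?P"
  proof (cases P)
    case (Inl a)
    then show ?thesis using P(1) T_atom by (auto simp: prepoints_def verts_cover)
  next
    case (Inr dt)
    obtain d t where dt: "P = Inr (d, t)" using Inr by (cases dt) auto
    then have d: "d \<in> arcs C" using P(1) by (auto simp: prepoints_def)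
    let ?u = "i (tail C d)" and ?v = "i (head C d)"
    have ends: "tail C d \<in> A" "head C d \<in> A"
      using C.tail_in_verts[OF d] C.head_in_verts[OF d] by (simp_all add: verts_cover)
    have uv: "?T ?u = L ?u + b" "?T ?v = L ?v + b"
      using ends by (simp_all add: L(2) atom_map_in_cycles1)
    have "?T (vertex_interpolation C i P) = L ((1 - t) *\<^sub>R ?u + t *\<^sub>R ?v) + b"
      using L(2) vertex_interpolation_atom_map_in_cycles1[OF P(1)] by (simp add: dt)
    also have "\<dots> = (1 - t) *\<^sub>R ?T ?u + t *\<^sub>R ?T ?v"
      unfolding uv by (simp add: linear_add[OF L(1)] linear_diff[OF L(1)] linear_cmul[OF L(1)] algebra_simps)
    also have "\<dots> = vertex_interpolation C i ?P"
      using graph_mapsD(3,4)[OF gm d] by (simp add: dt T_atom ends)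
    finally show ?thesis .
  qed
  then show ?thesis
    by (simp add: P(2) realization_map_class[OF gm] realization_embedding_glue_class P(1) gP)
qed

end

theorem theorem12:
  fixes X :: "('a,'b) pre_digraph" and iv :: "'b \<Rightarrow> 'b" and x0 :: 'a
  assumes "bidirected_digraph X iv"
    and "Digraph_Component.connected X"
    and "bridgeless X iv"
    and "x0 \<in> verts X"
    and "\<exists>B. finite B \<and> span B = cycles1 X iv"
  shows "\<forall>g\<in>carrier (Cov X iv x0).
    \<forall>p\<in>topspace (geometric_realization (cover X iv x0) (cover_inv X iv x0)).
      affine_Cov_action X iv x0 g (realization_embedding X iv x0 p) =
      realization_embedding X iv x0
        (realization_map (cover X iv x0) (cover_inv X iv x0) g p)"
proof -
  interpret bidirected_digraph X iv by (rule assms(1))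
  interpret based_cycle_finite_graph X iv x0
    by unfold_locales (use assms in simp_all)
  show ?thesis using realization_embedding_equivariant by blast
qed

end
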